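(* Let $\alpha$ be a composition of $n>0$. The map $\varphi$, sending $w\in\mathfrak{S}_\alpha(231)$ to the northeast path $\varphi(w)=[f_0,f_1,\dots,f_n]$ with $$f_i=\bigl|\{j\mid 1\le j\le n,\ \mathrm{code}_\alpha(w)_j+s_{\varrho(j)}=i\}\bigr|\qquad(0\le i\le n),$$ is an isomorphism (of posets) from the $\alpha$-Tamari lattice $\mathcal{T}_\alpha$ to the $\nu_\alpha$-Tamari lattice $\mathcal{T}_{\nu_\alpha}$.
   Context: Let $n>0$, $[n]=\{1,\dots,n\}$, and let $\alpha=(\alpha_1,\dots,\alpha_r)$ be a composition of $n$ (positive integers summing to $n$). Put $s_0=0$ and $s_a=\alpha_1+\cdots+\alpha_a$ for $a\in[r]$. The $a$-th $\alpha$-region is $\{s_{a-1}+1,\dots,s_a\}$, and $\varrho(i)$ denotes the index of the region containing $i$. $\mathfrak{S}_\alpha=\{w\in\mathfrak{S}_n\mid w(i)<w(i+1)\text{ whenever }\varrho(i)=\varrho(i+1)\}$; write $w_i=w(i)$. An element $w\in\mathfrak{S}_\alpha$ has an $(\alpha,231)$-pattern if there are indices $i<j<k$, each in a different $\alpha$-region, with $w_i<w_j$ and $w_i=w_k+1$. $\mathfrak{S}_\alpha(231)$ is the set of $w\in\mathfrak{S}_\alpha$ having no such pattern. With $\mathrm{Inv}(w)=\{(i,j)\mid i<j,\ w_i>w_j\}$, the weak order is $u\leq_L v\iff\mathrm{Inv}(u)\subseteq\mathrm{Inv}(v)$, and $\mathcal{T}_\alpha=(\mathfrak{S}_\alpha(231),\leq_L)$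 (known to be a lattice). For $w\in\mathfrak{S}_\alpha$, $\mathrm{code}_\alpha(w)=(c_1,\dots,c_n)$ where $c_i$ is the largest $k\ge 0$ (with $s_{\varrho(i)}+k\le n$) such that $w_i>w_{s_{\varrho(i)}+1},\ w_i>w_{s_{\varrho(i)}+2},\dots,\ w_i>w_{s_{\varrho(i)}+k}$. A northeast path is a lattice path (starting on the $x$-axis, say at the origin) made of north steps $N=(0,1)$ and east steps $E=(1,0)$. Write $[a_0,a_1,\dots,a_k]$ for the path $E^{a_0}NE^{a_1}N\cdots NE^{a_k}$. The $\alpha$-bounce path is $\nu_\alpha=N^{\alpha_1}E^{\alpha_1}N^{\alpha_2}E^{\alpha_2}\cdots N^{\alpha_r}E^{\alpha_r}$. For a northeast path $\nu$, $\mathcal{L}_\nu$ is the set of northeast paths with the same starting and ending points as $\nu$ that never go below $\nu$. For a lattice point $Q$ on $\mu\in\mathcal{L}_\nu$, $\mathrm{horiz}_\nu(Q)$ is the largest number of east steps that can be added to $Q$ without crossing to the other side of $\nu$ (i.e. the $x$-coordinate of the rightmost point of $\nu$ at the height of $Q$, minus the $x$-coordinate of $Q$). A valley of $\mu$ is a lattice point $V$ on $\mu$ preceded by an east step and followed by a north step. The rotation of $\mu$ by a valley $V$ is the path $\mu'\in\mathcal{L}_\nu$ obtained by exchanging the east step before $V$ with the portion of $\mu$ between $V$ and the next lattice point $W$ on $\mu$ after $V$ with $\mathrm{horiz}_\nu(W)=\mathrm{horiz}_\nu(V)$; then $\mu$ is placed below $\mu'$. The reflexive and transitive closure is a partial order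 on $\mathcal{L}_\nu$, and the resulting poset is the $\nu$-Tamari lattice $\mathcal{T}_\nu$. *)

theory Defs
  imports "HOL-Combinatorics.Permutations"
begin

subsection \<open>Posets\<close>

definition poset_iso :: "'a set \<Rightarrow> 'a rel \<Rightarrow> 'b set \<Rightarrow> 'b rel \<Rightarrow> ('a \<Rightarrow> 'b) \<Rightarrow> bool" where
  "poset_iso A r B s f \<longleftrightarrow>
     partial_order_on A r \<and> partial_order_on B s \<and> bij_betw f A B \<and>
     (\<forall>x\<in>A. \<forall>y\<in>A. (x, y) \<in> r \<longleftrightarrow> (f x, f y) \<in> s)"


subsection \<open>Compositions and their regions\<close>

definition is_composition :: "nat \<Rightarrow> nat list \<Rightarrow> bool" where
  "is_composition n \<alpha> \<longleftrightarrow> (\<forall>a\<in>set \<alpha>. 0 < a) \<and> sum_list \<alpha> = n"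

text \<open>
  Below, \<open>\<alpha>\<close> is a composition and \<open>n\<close> is recovered as \<^term>\<open>sum_list \<alpha>\<close>. The part
  $\alpha_a$ is the list entry \<open>\<alpha> ! (a - 1)\<close>, and regions are numbered from 1.
\<close>

definition psum :: "nat list \<Rightarrow> nat \<Rightarrow> nat" where
  "psum \<alpha> a = sum_list (take a \<alpha>)"

definition region :: "nat list \<Rightarrow> nat \<Rightarrow> nat set" where
  "region \<alpha> a = {psum \<alpha> (a - 1) + 1..psum \<alpha> a}"

definition region_index :: "nat list \<Rightarrow> nat \<Rightarrow> nat" where
  "region_index \<alpha> i = (THE a. a \<in> {1..length \<alpha>} \<and> i \<in> region \<alpha> a)"


subsection \<open>The \<open>\<alpha>\<close>-Tamari lattice\<close>

definition alpha_perms :: "nat list \<Rightarrow> (nat \<Rightarrow> nat) set" where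
  "alpha_perms \<alpha> =
     {w. w permutes {1..sum_list \<alpha>} \<and>
         (\<forall>i. 1 \<le> i \<and> i + 1 \<le> sum_list \<alpha> \<and> region_index \<alpha> i = region_index \<alpha> (i + 1)
              \<longrightarrow> w i < w (i + 1))}"

definition has_231_pattern :: "nat list \<Rightarrow> (nat \<Rightarrow> nat) \<Rightarrow> bool" where
  "has_231_pattern \<alpha> w \<longleftrightarrow>
     (\<exists>i j k. 1 \<le> i \<and> i < j \<and> j < k \<and> k \<le> sum_list \<alpha> \<and>
        region_index \<alpha> i \<noteq> region_index \<alpha> j \<and>
        region_index \<alpha> j \<noteq> region_index \<alpha> k \<and>
        region_index \<alpha> i \<noteq> region_index \<alpha> k \<and>
        w i < w j \<and> w i = w k + 1)"

definition alpha_perms_231 :: "nat list \<Rightarrow> (nat \<Rightarrow> nat) set" where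
  "alpha_perms_231 \<alpha> = {w \<in> alpha_perms \<alpha>. \<not> has_231_pattern \<alpha> w}"

definition Inv :: "nat \<Rightarrow> (nat \<Rightarrow> nat) \<Rightarrow> (nat \<times> nat) set" where
  "Inv n w = {(i, j). 1 \<le> i \<and> i < j \<and> j \<le> n \<and> w i > w j}"

definition alpha_tamari_le :: "nat list \<Rightarrow> (nat \<Rightarrow> nat) rel" where
  "alpha_tamari_le \<alpha> =
     {(u, v). u \<in> alpha_perms_231 \<alpha> \<and> v \<in> alpha_perms_231 \<alpha> \<and>
              Inv (sum_list \<alpha>) u \<subseteq> Inv (sum_list \<alpha>) v}"


subsection \<open>Northeast paths\<close>

text \<open>
  All paths start at the origin, so that a path is just its list of steps. The lattice points on
  \<open>\<mu>\<close> are \<open>path_point \<mu> k\<close> for \<open>k \<le> length \<mu>\<close>, and they are pairwise distinct.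
\<close>

datatype step = North | East

type_synonym path = "step list"

definition path_point :: "path \<Rightarrow> nat \<Rightarrow> nat \<times> nat" where
  "path_point \<mu> k = (count_list (take k \<mu>) East, count_list (take k \<mu>) North)"

definition path_points :: "path \<Rightarrow> (nat \<times> nat) set" where
  "path_points \<mu> = path_point \<mu> ` {..length \<mu>}"

definition path_end :: "path \<Rightarrow> nat \<times> nat" where
  "path_end \<mu> = path_point \<mu> (length \<mu>)"

text \<open>The path $[a_0,a_1,\dots,a_k] = E^{a_0}NE^{a_1}N\cdots NE^{a_k}$.\<close>

fun path_of :: "nat list \<Rightarrow> path" where
  "path_of [] = []"
| "path_of (a # as) = replicate a East @ concat (map (\<lambda>b. North # replicate b East) as)"

definition bounce_path :: "nat list \<Rightarrow> path" where
  "bounce_path \<alpha> = concat (map (\<lambda>a. replicate a North @ replicate a East) \<alpha>)"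


subsection \<open>The \<open>\<nu>\<close>-Tamari lattice\<close>

text \<open>
  A path may contain several points with the same abscissa; a point of \<open>\<mu>\<close> is below \<open>\<nu>\<close> when it is
  below all the points of \<open>\<nu>\<close> with its abscissa.
\<close>

definition never_below :: "path \<Rightarrow> path \<Rightarrow> bool" where
  "never_below \<mu> \<nu> \<longleftrightarrow>
     (\<forall>x y. (x, y) \<in> path_points \<mu> \<longrightarrow> (\<exists>y'. (x, y') \<in> path_points \<nu> \<and> y' \<le> y))"

definition paths_above :: "path \<Rightarrow> path set" where
  "paths_above \<nu> = {\<mu>. path_end \<mu> = path_end \<nu> \<and> never_below \<mu> \<nu>}"

definition horiz :: "path \<Rightarrow> nat \<times> nat \<Rightarrow> int" where
  "horiz \<nu> Q = int (Max {x. (x, snd Q) \<in> path_points \<nu>}) - int (fst Q)"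

text \<open>Points of \<open>\<mu>\<close> are referred to by their position \<open>i\<close>, i.e. as \<open>path_point \<mu> i\<close>.\<close>

definition is_valley :: "path \<Rightarrow> nat \<Rightarrow> bool" where
  "is_valley \<mu> i \<longleftrightarrow> 0 < i \<and> i < length \<mu> \<and> \<mu> ! (i - 1) = East \<and> \<mu> ! i = North"

definition next_same_horiz :: "path \<Rightarrow> path \<Rightarrow> nat \<Rightarrow> nat" where
  "next_same_horiz \<nu> \<mu> i =
     (LEAST j. i < j \<and> j \<le> length \<mu> \<and> horiz \<nu> (path_point \<mu> j) = horiz \<nu> (path_point \<mu> i))"

definition rotation :: "path \<Rightarrow> path \<Rightarrow> nat \<Rightarrow> path" where
  "rotation \<nu> \<mu> i =
     (let j = next_same_horiz \<nu> \<mu> i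
      in take (i - 1) \<mu> @ take (j - i) (drop i \<mu>) @ [East] @ drop j \<mu>)"

definition nu_rotations :: "path \<Rightarrow> path rel" where
  "nu_rotations \<nu> =
     {(\<mu>, \<mu>'). \<mu> \<in> paths_above \<nu> \<and> \<mu>' \<in> paths_above \<nu> \<and>
               (\<exists>i. is_valley \<mu> i \<and> \<mu>' = rotation \<nu> \<mu> i)}"

text \<open>
  The restriction only removes the pairs \<open>(\<mu>, \<mu>)\<close> with \<open>\<mu>\<close> outside \<open>paths_above \<nu>\<close>, which the
  reflexive closure over the whole type adds.
\<close>

definition nu_tamari_le :: "path \<Rightarrow> path rel" where
  "nu_tamari_le \<nu> = (nu_rotations \<nu>)\<^sup>* \<inter> (paths_above \<nu> \<times> paths_above \<nu>)"


subsection \<open>The map \<open>\<phi>\<close>\<close>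

definition code :: "nat list \<Rightarrow> (nat \<Rightarrow> nat) \<Rightarrow> nat \<Rightarrow> nat" where
  "code \<alpha> w i =
     (let s = psum \<alpha> (region_index \<alpha> i)
      in Max {k. s + k \<le> sum_list \<alpha> \<and> (\<forall>l\<in>{1..k}. w i > w (s + l))})"

definition code_count :: "nat list \<Rightarrow> (nat \<Rightarrow> nat) \<Rightarrow> nat \<Rightarrow> nat" where
  "code_count \<alpha> w i =
     card {j. 1 \<le> j \<and> j \<le> sum_list \<alpha> \<and> code \<alpha> w j + psum \<alpha> (region_index \<alpha> j) = i}"

definition phi :: "nat list \<Rightarrow> (nat \<Rightarrow> nat) \<Rightarrow> path" where
  "phi \<alpha> w = path_of (map (code_count \<alpha> w) [0..<sum_list \<alpha> + 1])"

end

theory Submission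
  imports Defs
begin

text \<open>
  Let \<open>R i\<close> be the last position of the region of \<open>i\<close>, and let
  $e_i = \mathrm{code}_\alpha(w)_i + R(i)$, so that \<open>e\<close> is the family of heights of the east steps
  of $\varphi(w)$. Read \<open>i\<close> as a bracket that opens at height \<open>R i\<close> and closes at height \<open>e i\<close>; these
  brackets are nested, which together with \<open>R i \<le> e i \<le> n\<close> characterises the families that occur.

  On the side of permutations, avoidance makes \<open>Inv w\<close> the transitive closure of the pairs
  \<open>(i, j)\<close> with \<open>R i < j \<le> e i\<close>. Hence the weak order is the componentwise order of the families
  \<open>e\<close>, and conversely this transitive closure is the inversion set of a permutation for every nested
  \<open>e\<close>. On the side of paths, a nested family is determined by its multiset of values, since the
  brackets of the last region must take the smallest available heights, and so on. A rotation at
  height \<open>h\<close> raises the outermost bracket closing at \<open>h\<close> by the least amount that keeps the family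
  nested, so that the rotations generate the componentwise order as well.
\<close>

subsection \<open>Nested families\<close>

text \<open>The disjunction says that the bracket \<open>j\<close> opens after \<open>i\<close>.
  Indices of one region open at the same height, and there the larger index counts as the outer
  bracket, matching permutations that increase inside a region.\<close>

definition nested_on :: "nat set \<Rightarrow> (nat \<Rightarrow> nat) \<Rightarrow> (nat \<Rightarrow> nat) \<Rightarrow> bool" where
  "nested_on A R e \<longleftrightarrow> (\<forall>i\<in>A. R i \<le> e i) \<and>
     (\<forall>i\<in>A. \<forall>j\<in>A. (R i < R j \<or> R i = R j \<and> j < i) \<longrightarrow> R j \<le> e i \<longrightarrow> e j \<le> e i)"

text \<open>The innermost bracket is the smallest index among those with the largest
  \<open>R\<close>. Nestedness then compares it with every other index in the same direction, which
  drives the inductions below.\<close>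

lemma first_to_close:
  fixes R :: "nat \<Rightarrow> nat"
  assumes "finite A" "A \<noteq> {}"
  obtains j where "j \<in> A" "\<And>i. i \<in> A \<Longrightarrow> i \<noteq> j \<Longrightarrow> R i < R j \<or> R i = R j \<and> j < i"
proof -
  define m where "m = Max (R ` A)"
  define B where "B = {i \<in> A. R i = m}"
  have "m \<in> R ` A" using assms unfolding m_def by (intro Max_in) auto
  hence B: "finite B" "B \<noteq> {}" using assms by (auto simp: B_def)
  have "Min B \<in> B" using B by (rule Min_in)
  show ?thesis
  proof (rule that[of "Min B"])
    show "Min B \<in> A" using \<open>Min B \<in> B\<close> by (simp add: B_def)
    fix i assume i: "i \<in> A" "i \<noteq> Min B"
    have "R i \<le> m" using i assms(1) by (simp add: m_def)
    moreover have "R (Min B) = m" using \<open>Min B \<in> B\<close> by (simp add: B_def)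
    moreover have "Min B < i" if "R i = m"
    proof -
      have "i \<in> B" using that i by (simp add: B_def)
      thus ?thesis using B(1) i(2) by (simp add: order.strict_iff_order)
    qed
    ultimately show "R i < R (Min B) \<or> R i = R (Min B) \<and> Min B < i" by fastforce
  qed
qed

lemma nested_on_subset: "nested_on A R e \<Longrightarrow> B \<subseteq> A \<Longrightarrow> nested_on B R e"
  unfolding nested_on_def by blast

text \<open>The innermost index must take the least value that is at least \<open>R j\<close>, and
  this depends only on the multiset of values. Removing that index and its value leaves a smaller
  instance.\<close>

lemma nested_on_unique:
  assumes "finite A" "nested_on A R e" "nested_on A R e'"
    and "image_mset e (mset_set A) = image_mset e' (mset_set A)" "i \<in> A"
  shows "e i = e' i"
  using assms
proof (induction A arbitrary: i rule: finite_psubset_induct)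
  case (psubset A)
  from psubset.hyps psubset.prems(4) obtain j where j: "j \<in> A"
    "\<And>i. i \<in> A \<Longrightarrow> i \<noteq> j \<Longrightarrow> R i < R j \<or> R i = R j \<and> j < i"
    using first_to_close[of A R] by blast
  have least: "d j \<le> x" if "nested_on A R d" "x \<in> d ` A" "R j \<le> x" for d x
    using that j unfolding nested_on_def by (metis imageE order_refl)
  have im: "e ` A = e' ` A"
    using arg_cong[OF psubset.prems(3), of set_mset] psubset.hyps by simp
  have "R j \<le> e j" "R j \<le> e' j" using j psubset.prems by (auto simp: nested_on_def)
  hence ej: "e j = e' j"
    using least[OF psubset.prems(1), of "e' j"] least[OF psubset.prems(2), of "e j"] im j(1)
    by (metis imageI order_antisym)
  have split: "mset_set A = add_mset j (mset_set (A - {j}))"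
    using j(1) psubset.hyps by (simp add: mset_set.remove)
  show ?case
  proof (cases "i = j")
    case False
    have "image_mset e (mset_set (A - {j})) = image_mset e' (mset_set (A - {j}))"
      using psubset.prems(3) ej by (simp add: split)
    thus ?thesis using psubset.IH[of "A - {j}" i] False j(1) psubset.prems nested_on_subset
      by (metis Diff_iff Diff_subset empty_iff insert_iff psubsetI)
  qed (simp add: ej)
qed

text \<open>The indices choose in turn, starting with those of the last region; each takes the least
  admissible value that is still available.\<close>

lemma nested_on_exists:
  assumes "finite A" "size M = card A"
    and "\<And>h. size {#x \<in># M. x \<le> h#} \<le> card {i \<in> A. R i \<le> h}"
  shows "\<exists>e. nested_on A R e \<and> image_mset e (mset_set A) = M"
  using assms
proof (induction A arbitrary: M rule: finite_psubset_induct)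
  case (psubset A)
  show ?case
  proof (cases "A = {}")
    case True
    thus ?thesis using psubset.prems by (auto simp: nested_on_def)
  next
    case False
    then obtain j where j: "j \<in> A"
      "\<And>i. i \<in> A \<Longrightarrow> i \<noteq> j \<Longrightarrow> R i < R j \<or> R i = R j \<and> j < i"
      using first_to_close[of A R] psubset.hyps by blast
    define X where "X = {x \<in> set_mset M. R j \<le> x}"
    \<comment> \<open>The counting hypothesis at height \<open>R j - 1\<close>; for
      \<open>R j = 0\<close> there is nothing to count.\<close>
    have low: "size {#x \<in># M. x < R j#} \<le> card {i \<in> A. R i < R j}"
    proof (cases "R j")
      case (Suc r)
      have "(x < R j) = (x \<le> r)" for x by (simp add: Suc less_Suc_eq_le)
      thus ?thesis using psubset.prems(2)[of r] by simp
    qed simp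
    \<comment> \<open>The index \<open>j\<close> is not counted on the left, so some value of
      \<open>M\<close> must be at least \<open>R j\<close>.\<close>
    have "card {i \<in> A. R i < R j} < card A"
      using psubset.hyps j(1) by (intro psubset_card_mono) auto
    hence "{#x \<in># M. x < R j#} \<noteq> M" using low psubset.prems(1) by auto
    hence "X \<noteq> {}"
      using filter_mset_cong[of M M "\<lambda>x. x < R j" "\<lambda>_. True"] by (force simp: X_def not_le)
    moreover have "finite X" by (simp add: X_def)
    ultimately have y: "Min X \<in> X" by simp
    define y where "y = Min X"
    have yM: "y \<in># M" "R j \<le> y" using y by (auto simp: X_def y_def)
    have ymin: "y \<le> x" if "x \<in># M" "R j \<le> x" for x
      using that \<open>finite X\<close> by (auto simp: X_def y_def)
    define N where "N = M - {#y#}"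
    have M: "M = add_mset y N" using yM by (simp add: N_def)
    have "size {#x \<in># N. x \<le> h#} \<le> card {i \<in> A - {j}. R i \<le> h}" for h
    proof -
      \<comment> \<open>Below \<open>R j\<close> both counts stay as they were. Between
        \<open>R j\<close> and \<open>y\<close> no value occurs, by minimality of \<open>y\<close>,
        so \<open>low\<close> suffices. From \<open>y\<close> on both counts drop by one.\<close>
      consider "h < R j" | "R j \<le> h" "h < y" | "y \<le> h" by linarith
      thus ?thesis
      proof cases
        case 1
        hence "{i \<in> A - {j}. R i \<le> h} = {i \<in> A. R i \<le> h}" by auto
        thus ?thesis using psubset.prems(2)[of h] 1 yM by (simp add: M)
      next
        case 2
        have "{#x \<in># N. x \<le> h#} = {#x \<in># N. x < R j#}"
          using 2 ymin by (intro filter_mset_cong refl) (force simp: M)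
        hence "size {#x \<in># N. x \<le> h#} \<le> card {i \<in> A. R i < R j}"
          using low yM by (simp add: M)
        also have "\<dots> \<le> card {i \<in> A - {j}. R i \<le> h}"
          using 2 psubset.hyps by (intro card_mono) auto
        finally show ?thesis .
      next
        case 3
        have "{i \<in> A. R i \<le> h} = insert j {i \<in> A - {j}. R i \<le> h}" using 3 yM j(1) by auto
        hence "card {i \<in> A. R i \<le> h} = Suc (card {i \<in> A - {j}. R i \<le> h})"
          using psubset.hyps by simp
        thus ?thesis using psubset.prems(2)[of h] 3 by (simp add: M)
      qed
    qed
    moreover have "size N = card (A - {j})"
      using psubset.prems(1) j(1) psubset.hyps by (simp add: M)
    ultimately obtain e where e: "nested_on (A - {j}) R e" "image_mset e (mset_set (A - {j})) = N"
      using psubset.IH[of "A - {j}" N] j(1) by auto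
    define e' where "e' = e(j := y)"
    have im: "image_mset e' (mset_set (A - {j})) = N"
      unfolding e(2)[symmetric] using psubset.hyps by (intro image_mset_cong) (auto simp: e'_def)
    have "image_mset e' (mset_set A) = M"
      using im j(1) psubset.hyps by (simp add: mset_set.remove[of A j] M e'_def)
    moreover have "nested_on A R e'"
      unfolding nested_on_def
    proof (intro conjI ballI impI)
      fix i assume "i \<in> A"
      thus "R i \<le> e' i" using e(1) yM by (auto simp: e'_def nested_on_def)
    next
      fix i k assume ik: "i \<in> A" "k \<in> A" "R i < R k \<or> R i = R k \<and> k < i" "R k \<le> e' i"
      have "i \<noteq> j" using ik j(2)[of k] by (metis less_asym less_irrefl)
      hence "e' i \<in># N" using ik(1) psubset.hyps by (simp flip: im)
      show "e' k \<le> e' i"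
      proof (cases "k = j")
        case True
        thus ?thesis using ymin[of "e' i"] \<open>e' i \<in># N\<close> ik(4) by (simp add: M e'_def)
      next
        case False
        thus ?thesis using e(1) ik \<open>i \<noteq> j\<close> by (auto simp: nested_on_def e'_def)
      qed
    qed
    ultimately show ?thesis by blast
  qed
qed

subsection \<open>Inversion sets of avoiding permutations\<close>

text \<open>The composition enters only through the function \<open>R\<close> that maps a position to the last
  position of its region.\<close>

locale regions =
  fixes n :: nat and R :: "nat \<Rightarrow> nat"
  assumes R_ge: "1 \<le> i \<Longrightarrow> i \<le> n \<Longrightarrow> i \<le> R i"
    and R_le: "1 \<le> i \<Longrightarrow> i \<le> n \<Longrightarrow> R i \<le> n"
    and R_const: "1 \<le> i \<Longrightarrow> i \<le> n \<Longrightarrow> i \<le> j \<Longrightarrow> j \<le> R i \<Longrightarrow> R j = R i"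
begin

lemma R_mono:
  assumes "1 \<le> i" "i \<le> j" "j \<le> n"
  shows "R i \<le> R j"
proof (cases "j \<le> R i")
  case False
  thus ?thesis using R_ge[of j] assms by simp
qed (use R_const[of i j] assms in simp)

lemma R_R: "1 \<le> i \<Longrightarrow> i \<le> n \<Longrightarrow> R (R i) = R i"
  using R_const[of i "R i"] R_ge by simp

lemma R_less_imp_less: "1 \<le> i \<Longrightarrow> 1 \<le> j \<Longrightarrow> i \<le> n \<Longrightarrow> R i < R j \<Longrightarrow> i < j"
  using R_mono[of j i] by (meson leD leI)

lemma R_less_iff: "1 \<le> i \<Longrightarrow> i \<le> n \<Longrightarrow> 1 \<le> j \<Longrightarrow> j \<le> n \<Longrightarrow> R i < R j \<longleftrightarrow> R i < j"
  using R_ge[of j] R_const[of i j] R_less_imp_less[of i j] by fastforce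

definition increasing :: "(nat \<Rightarrow> nat) \<Rightarrow> bool" where
  "increasing w \<longleftrightarrow> w permutes {1..n} \<and>
     (\<forall>i j. 1 \<le> i \<and> i < j \<and> j \<le> n \<and> R i = R j \<longrightarrow> w i < w j)"

definition avoiding :: "(nat \<Rightarrow> nat) \<Rightarrow> bool" where
  "avoiding w \<longleftrightarrow> (\<forall>i j k. 1 \<le> i \<and> i < j \<and> j < k \<and> k \<le> n \<and>
     R i \<noteq> R j \<and> R j \<noteq> R k \<and> w i < w j \<longrightarrow> w i \<noteq> w k + 1)"

text \<open>Positions are used instead of lengths: \<open>m\<close> stands for the sum of
  \<open>R i\<close> and a candidate for the code, so that the maximum is the height
  \<open>e i\<close> itself.\<close>

definition reach_set :: "(nat \<Rightarrow> nat) \<Rightarrow> nat \<Rightarrow> nat set" where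
  "reach_set w i = {m. R i \<le> m \<and> m \<le> n \<and> (\<forall>l. R i < l \<and> l \<le> m \<longrightarrow> w l < w i)}"

definition reach :: "(nat \<Rightarrow> nat) \<Rightarrow> nat \<Rightarrow> nat" where
  "reach w i = Max (reach_set w i)"

lemma finite_reach_set: "finite (reach_set w i)"
  by (rule finite_subset[of _ "{..n}"]) (auto simp: reach_set_def)

lemma reach_in_set:
  assumes "1 \<le> i" "i \<le> n"
  shows "reach w i \<in> reach_set w i"
proof -
  have "R i \<in> reach_set w i" using assms R_le by (auto simp: reach_set_def)
  thus ?thesis unfolding reach_def using finite_reach_set by (intro Max_in) auto
qed

lemma le_reach: "m \<in> reach_set w i \<Longrightarrow> m \<le> reach w i"
  unfolding reach_def using finite_reach_set by simp

lemma R_le_reach: "1 \<le> i \<Longrightarrow> i \<le> n \<Longrightarrow> R i \<le> reach w i"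
  and reach_le: "1 \<le> i \<Longrightarrow> i \<le> n \<Longrightarrow> reach w i \<le> n"
  and reach_less: "1 \<le> i \<Longrightarrow> i \<le> n \<Longrightarrow> R i < l \<Longrightarrow> l \<le> reach w i \<Longrightarrow> w l < w i"
  using reach_in_set by (auto simp: reach_set_def)

lemma reach_eqI:
  assumes "e \<in> reach_set w i" "e < n \<Longrightarrow> w i \<le> w (e + 1)"
  shows "reach w i = e"
proof -
  have "m \<le> e" if "m \<in> reach_set w i" for m
  proof (rule ccontr)
    assume "\<not> m \<le> e"
    hence "e < n" "w (e + 1) < w i" using that assms(1) by (auto simp: reach_set_def)
    thus False using assms(2) by simp
  qed
  thus ?thesis unfolding reach_def using assms(1) finite_reach_set by (intro Max_eqI) auto
qed

text \<open>If \<open>j\<close> opens inside the run of \<open>i\<close>, then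
  \<open>w j < w i\<close>; all values that \<open>w j\<close> exceeds are then exceeded by
  \<open>w i\<close> too, and the run of \<open>i\<close> extends at least to the end of the run of
  \<open>j\<close>.\<close>

lemma nested_on_reach:
  assumes "increasing w"
  shows "nested_on {1..n} R (reach w)"
  unfolding nested_on_def
proof (intro conjI ballI impI)
  fix i assume "i \<in> {1..n}"
  thus "R i \<le> reach w i" by (simp add: R_le_reach)
next
  fix i j assume i: "i \<in> {1..n}" and j: "j \<in> {1..n}"
    and before: "R i < R j \<or> R i = R j \<and> j < i" and le: "R j \<le> reach w i"
  have lt: "w j < w i"
    using before
  proof
    assume "R i < R j"
    thus ?thesis using i j le R_less_iff[of i j] R_ge[of j] reach_less[of i j w] by simp
  qed (use assms i j in \<open>auto simp: increasing_def\<close>)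
  have "w l < w i" if "R i < l" "l \<le> reach w j" for l
  proof (cases "l \<le> R j")
    case True
    thus ?thesis using that i le by (simp add: reach_less)
  next
    case False
    thus ?thesis using that j lt reach_less[of j l w] by simp
  qed
  moreover have "R i \<le> reach w j" using before R_le_reach[of j w] j by auto
  ultimately have "reach w j \<in> reach_set w i" using j reach_le by (simp add: reach_set_def)
  thus "reach w j \<le> reach w i" by (rule le_reach)
qed

text \<open>For \<open>e = reach w\<close> these are the inversions that the code shows directly;
  all others are to arise by transitivity.\<close>

definition below :: "(nat \<Rightarrow> nat) \<Rightarrow> (nat \<times> nat) set" where
  "below e = {(i, j). 1 \<le> i \<and> i \<le> n \<and> R i < j \<and> j \<le> e i}"

lemma below_mono: "(\<And>i. i \<in> {1..n} \<Longrightarrow> e i \<le> e' i) \<Longrightarrow> below e \<subseteq> below e'"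
  unfolding below_def by force

lemma Inv_iff: "(i, j) \<in> Inv n w \<longleftrightarrow> 1 \<le> i \<and> i < j \<and> j \<le> n \<and> w j < w i"
  by (auto simp: Inv_def)

lemma increasingD:
  "increasing w \<Longrightarrow> 1 \<le> i \<Longrightarrow> i < j \<Longrightarrow> j \<le> n \<Longrightarrow> R i = R j \<Longrightarrow> w i < w j"
  by (simp add: increasing_def)

lemma increasing_Inv:
  assumes "increasing w" "(i, j) \<in> Inv n w"
  shows "R i < j"
proof (rule ccontr)
  assume "\<not> R i < j"
  hence "R j = R i" using R_const[of i j] assms(2) by (simp add: Inv_iff)
  hence "w i < w j" using assms increasingD[of w i j] by (simp add: Inv_iff)
  thus False using assms(2) by (simp add: Inv_iff)
qed

text \<open>Induction on the gap between the two values. An intermediate value at an intermediate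
  position splits the inversion into two with smaller gaps; without one, avoidance puts the pair in
  \<open>below\<close> itself.\<close>

lemma Inv_subset_trancl_below:
  assumes w: "increasing w" "avoiding w" and ik: "(i, k) \<in> Inv n w"
  shows "(i, k) \<in> (below (reach w))\<^sup>+"
  using ik
proof (induction "w i - w k" arbitrary: i k rule: less_induct)
  case less
  note ik = less.prems[unfolded Inv_iff]
  show ?case
  proof (cases "\<exists>p. i < p \<and> p < k \<and> w k < w p \<and> w p < w i")
    case True
    then obtain p where p: "i < p" "p < k" "w k < w p" "w p < w i" by blast
    have "(i, p) \<in> (below (reach w))\<^sup>+" "(p, k) \<in> (below (reach w))\<^sup>+"
      using p ik less.hyps[of i p] less.hyps[of p k] by (auto simp: Inv_iff)
    thus ?thesis by (rule trancl_trans)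
  next
    case False
    have perm: "w permutes {1..n}" using w(1) by (simp add: increasing_def)
    note inj = permutes_inj[OF perm, THEN injD]
    define pos where "pos = inv w"
    have w_pos: "w (pos v) = v" for v
      unfolding pos_def using perm by (rule permutes_inverses)
    have pos_w: "pos (w x) = x" for x
      unfolding pos_def using perm by (rule permutes_inverses)
    have pos_in: "pos v \<in> {1..n} \<longleftrightarrow> v \<in> {1..n}" for v
      unfolding pos_def using permutes_in_image[OF permutes_inv[OF perm]] .
    have wi: "w i \<in> {1..n}" "w k \<in> {1..n}" 
      using permutes_in_image[OF perm, of i] permutes_in_image[OF perm, of k] ik by auto
    \<comment> \<open>No value between \<open>w k\<close> and \<open>w i\<close> sits strictly between \<open>i\<close> and \<open>k\<close>, so some consecutive
      values \<open>v + 1\<close> and \<open>v\<close> sit weakly to the left of \<open>i\<close> and to the right of \<open>k\<close>; avoidance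
      applied to them bounds all values in the regions in between.\<close>
    define V where "V = {v. w k \<le> v \<and> v < w i \<and> k \<le> pos v}"
    have "finite V" by (rule finite_subset[of _ "{..w i}"]) (auto simp: V_def)
    have "w k \<in> V" using ik by (simp add: V_def pos_w)
    define v where "v = Max V"
    have "v \<in> V" unfolding v_def using \<open>finite V\<close> \<open>w k \<in> V\<close> by (intro Max_in) auto
    hence v: "w k \<le> v" "v < w i" "k \<le> pos v" by (auto simp: V_def)
    have "v + 1 \<notin> V" using Max_ge[OF \<open>finite V\<close>, of "v + 1"] by (auto simp flip: v_def)
    have left: "pos (v + 1) \<le> i"
    proof (cases "v + 1 = w i")
      case True
      thus ?thesis by (simp add: pos_w)
    next
      case neq: False
      hence "pos (v + 1) < k" using \<open>v + 1 \<notin> V\<close> v by (auto simp: V_def)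
      moreover have "w k < v + 1" "v + 1 < w i" using v neq by auto
      ultimately show ?thesis using False w_pos[of "v + 1"] by (metis not_le)
    qed
    have range: "1 \<le> pos (v + 1)" "pos v \<le> n"
      using pos_in[of "v + 1"] pos_in[of v] v wi by auto
    have "R i < k" using w(1) less.prems by (rule increasing_Inv)
    have "i \<le> R i" using R_ge ik by simp
    have "w l < w i" if l: "R i < l" "l \<le> k" for l
    \<comment> \<open>In the region of \<open>k\<close> the values up to position \<open>k\<close>
      are at most \<open>w k\<close>. In an earlier region, \<open>w l > v + 1\<close> would make
      the positions of \<open>v + 1\<close>, \<open>l\<close> and the position of \<open>v\<close> a
      forbidden pattern.\<close>
    proof (cases "R l = R k")
      case True
      moreover have "1 \<le> l" using l \<open>i \<le> R i\<close> ik by simp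
      ultimately have "l < k \<Longrightarrow> w l < w k" using w(1) ik by (simp add: increasing_def)
      thus ?thesis using ik l by (cases "l = k") auto
    next
      case ne: False
      hence "l < k" using l by (cases "l = k") auto
      have "R (pos (v + 1)) \<le> R i" using R_mono left range ik by simp
      moreover have "R i < R l" using R_less_iff[of i l] l ik \<open>i \<le> R i\<close> by simp
      moreover have "R l \<le> R k" "R k \<le> R (pos v)"
        using R_mono[of l k] R_mono[of k "pos v"] \<open>l < k\<close> l ik v(3) range by auto
      ultimately have "\<not> w (pos (v + 1)) < w l"
        using w(2)[unfolded avoiding_def, rule_format, of "pos (v + 1)" l "pos v"]
          range left \<open>l < k\<close> v(3) \<open>i \<le> R i\<close> l ne by (auto simp: w_pos)
      hence "w l \<le> w i" using v by (simp add: w_pos)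
      moreover have "w l \<noteq> w i" using inj[of l i] l \<open>i \<le> R i\<close> by auto
      ultimately show ?thesis by simp
    qed
    hence "k \<in> reach_set w i" using ik \<open>R i < k\<close> by (auto simp: reach_set_def)
    hence "(i, k) \<in> below (reach w)" using ik \<open>R i < k\<close> by (simp add: below_def le_reach)
    thus ?thesis by (rule r_into_trancl)
  qed
qed

lemma below_reach_subset_Inv: "below (reach w) \<subseteq> Inv n w"
proof (rule subrelI)
  fix i j assume "(i, j) \<in> below (reach w)"
  hence ij: "1 \<le> i" "i \<le> n" "R i < j" "j \<le> reach w i" by (auto simp: below_def)
  hence "w j < w i" "i \<le> R i" "reach w i \<le> n" by (simp_all add: reach_less R_ge reach_le)
  thus "(i, j) \<in> Inv n w" using ij by (simp add: Inv_iff)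
qed

lemma trans_Inv: "trans (Inv n w)"
  by (auto simp: trans_def Inv_def)

lemma Inv_eq_trancl_below:
  assumes "increasing w" "avoiding w"
  shows "Inv n w = (below (reach w))\<^sup>+"
proof
  show "Inv n w \<subseteq> (below (reach w))\<^sup>+" using Inv_subset_trancl_below[OF assms] by auto
  show "(below (reach w))\<^sup>+ \<subseteq> Inv n w"
    using trancl_mono_subset[OF below_reach_subset_Inv] trancl_id[OF trans_Inv] by blast
qed

text \<open>From left to right, the pairs in \<open>below (reach u)\<close> are inversions of
  \<open>v\<close>, so the runs of \<open>v\<close> are at least as long. From right to left,
  transitive closure is monotone.\<close>

lemma Inv_subset_iff:
  assumes "increasing u" "avoiding u" "increasing v" "avoiding v"
  shows "Inv n u \<subseteq> Inv n v \<longleftrightarrow> (\<forall>i\<in>{1..n}. reach u i \<le> reach v i)"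
proof
  assume sub: "Inv n u \<subseteq> Inv n v"
  show "\<forall>i\<in>{1..n}. reach u i \<le> reach v i"
  proof
    fix i assume i: "i \<in> {1..n}"
    have "v l < v i" if "R i < l" "l \<le> reach u i" for l
    proof -
      have "(i, l) \<in> below (reach u)" using i that by (simp add: below_def)
      thus ?thesis using below_reach_subset_Inv sub Inv_iff by blast
    qed
    hence "reach u i \<in> reach_set v i" using i R_le_reach reach_le by (simp add: reach_set_def)
    thus "reach u i \<le> reach v i" by (rule le_reach)
  qed
next
  assume "\<forall>i\<in>{1..n}. reach u i \<le> reach v i"
  hence "below (reach u) \<subseteq> below (reach v)" by (intro below_mono) auto
  thus "Inv n u \<subseteq> Inv n v"
    unfolding Inv_eq_trancl_below[OF assms(1,2)] Inv_eq_trancl_below[OF assms(3,4)]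
    by (rule trancl_mono_subset)
qed

end

section \<open>Permutations and their inversion sets\<close>

lemma permutes_eq_card:
  assumes "w permutes {1..n}" "i \<in> {1..n}"
  shows "w i = card {j \<in> {1..n}. w j \<le> w i}"
proof -
  have "w ` {j \<in> {1..n}. w j \<le> w i} = {1..w i}"
  proof (intro equalityI subsetI)
    fix v assume "v \<in> {1..w i}"
    moreover have "w i \<in> {1..n}" using assms permutes_in_image by metis
    ultimately have "v \<in> w ` {1..n}" using permutes_image[OF assms(1)] by auto
    thus "v \<in> w ` {j \<in> {1..n}. w j \<le> w i}" using \<open>v \<in> {1..w i}\<close> by auto
  next
    fix v assume "v \<in> w ` {j \<in> {1..n}. w j \<le> w i}"
    then obtain j where "j \<in> {1..n}" "w j \<le> w i" "v = w j" by auto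
    thus "v \<in> {1..w i}" using permutes_in_image[OF assms(1), of j] by simp
  qed
  moreover have "inj_on w {j \<in> {1..n}. w j \<le> w i}"
    using permutes_inj_on[OF assms(1)] by (rule inj_on_subset) auto
  ultimately show ?thesis using card_image[of w "{j \<in> {1..n}. w j \<le> w i}"] by simp
qed

text \<open>The inversion set decides every comparison between two values, and each value is its
  rank among all values.\<close>

lemma permutes_eq_if_Inv_eq:
  assumes "u permutes {1..n}" "v permutes {1..n}" "Inv n u = Inv n v"
  shows "u = v"
proof
  fix i
  show "u i = v i"
  proof (cases "i \<in> {1..n}")
    case True
    have "u j \<le> u i \<longleftrightarrow> v j \<le> v i" if j: "j \<in> {1..n}" for j
    proof -
      consider "i < j" | "i = j" | "j < i" by linarith
      thus ?thesis
      proof cases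
        case 1
        have "u j < u i \<longleftrightarrow> v j < v i"
          using arg_cong[OF assms(3), of "\<lambda>X. (i, j) \<in> X"] 1 True j by (auto simp: Inv_def)
        moreover have "u j \<noteq> u i" "v j \<noteq> v i"
          using permutes_inj[OF assms(1)] permutes_inj[OF assms(2)] 1 by (auto dest: injD)
        ultimately show ?thesis by auto
      next
        case 3
        have "u i < u j \<longleftrightarrow> v i < v j"
          using arg_cong[OF assms(3), of "\<lambda>X. (j, i) \<in> X"] 3 True j by (auto simp: Inv_def)
        thus ?thesis by (meson not_less)
      qed simp
    qed
    hence "{j \<in> {1..n}. u j \<le> u i} = {j \<in> {1..n}. v j \<le> v i}" by blast
    thus ?thesis using permutes_eq_card[OF assms(1) True] permutes_eq_card[OF assms(2) True] by simp
  next
    case False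
    thus ?thesis using assms by (simp add: permutes_not_in)
  qed
qed

text \<open>Transitivity and cotransitivity of \<open>T\<close> make the comparisons that it
  prescribes a strict linear order on the positions; ranking the positions in this order gives the
  permutation.\<close>

lemma permutation_with_inversions:
  fixes n :: nat
  assumes sub: "T \<subseteq> {(i, j). 1 \<le> i \<and> i < j \<and> j \<le> n}" and "trans T"
    and cotrans: "\<And>i j k. (i, k) \<in> T \<Longrightarrow> i < j \<Longrightarrow> j < k \<Longrightarrow> (i, j) \<in> T \<or> (j, k) \<in> T"
  shows "\<exists>w. w permutes {1..n} \<and> Inv n w = T"
proof -
  \<comment> \<open>\<open>prec i j\<close> is the prescribed outcome of \<open>w i < w j\<close>.
    The rank \<open>w\<close> counts the position itself, so that values start at 1.\<close>
  define prec where "prec = (\<lambda>i j. i < j \<and> (i, j) \<notin> T \<or> j < i \<and> (j, i) \<in> T)"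
  define w where "w = (\<lambda>i. if i \<in> {1..n} then card {j \<in> {1..n}. prec j i \<or> j = i} else i)"
  have total: "prec i j \<or> prec j i" if "i \<noteq> j" for i j
    using that by (auto simp: prec_def)
  have asym: "\<not> prec j i" if "prec i j" for i j
    using that by (auto simp: prec_def)
  have prec_trans: "prec i k" if "prec i j" "prec j k" for i j k
  proof -
    note T = transD[OF \<open>trans T\<close>]
    have neq: "i \<noteq> j" "j \<noteq> k" using that by (auto simp: prec_def)
    \<comment> \<open>Apart from the contradictory case \<open>i = k\<close>, each relative order of
      the three positions is settled by transitivity of \<open>T\<close> or by
      \<open>cotrans\<close>.\<close>
    consider "i < j" "j < k" | "j < i" "k < j" | "i = k" | "i < k" "k < j" | "k < i" "i < j"
      | "j < i" "i < k" | "j < k" "k < i"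
      using neq by linarith
    thus ?thesis
    proof cases
      case 3
      thus ?thesis using that asym by blast
    qed (use that T[of k j i] T[of i k j] T[of j i k] cotrans[of i k j] cotrans[of k j i] cotrans[of j i k] in \<open>auto simp: prec_def\<close>)
  qed
  have mono: "w i < w j" if "i \<in> {1..n}" "j \<in> {1..n}" "prec i j" for i j
  proof -
    have "{l \<in> {1..n}. prec l i \<or> l = i} \<subset> {l \<in> {1..n}. prec l j \<or> l = j}"
      using that prec_trans asym by blast
    hence "card {l \<in> {1..n}. prec l i \<or> l = i} < card {l \<in> {1..n}. prec l j \<or> l = j}"
      by (intro psubset_card_mono) auto
    thus ?thesis using that by (simp add: w_def)
  qed
  have "inj_on w {1..n}"
    by (rule inj_onI) (metis mono total less_irrefl)
  moreover have "w ` {1..n} \<subseteq> {1..n}"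
  proof clarify
    fix i assume i: "i \<in> {1..n}"
    have "card {j \<in> {1..n}. prec j i \<or> j = i} \<le> card {1..n}" by (rule card_mono) auto
    moreover have "0 < card {j \<in> {1..n}. prec j i \<or> j = i}" using i by (auto simp: card_gt_0_iff)
    ultimately show "w i \<in> {1..n}" using i by (auto simp: w_def)
  qed
  ultimately have "bij_betw w {1..n} {1..n}"
    by (simp add: bij_betw_def endo_inj_surj)
  hence "w permutes {1..n}" by (rule bij_imp_permutes) (simp add: w_def del: atLeastAtMost_iff)
  moreover have "(i, j) \<in> Inv n w \<longleftrightarrow> (i, j) \<in> T" for i j
  proof (cases "1 \<le> i \<and> i < j \<and> j \<le> n")
    case True
    hence "w j < w i \<longleftrightarrow> prec j i" using mono[of i j] mono[of j i] total[of i j] by auto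
    thus ?thesis using True by (auto simp: Inv_def prec_def)
  qed (use sub in \<open>auto simp: Inv_def\<close>)
  ultimately show ?thesis by (intro exI[of _ w]) auto
qed

section \<open>Realising a nested family by an avoiding permutation\<close>

context regions
begin

lemma trancl_below_bounds:
  assumes "(i, j) \<in> (below e)\<^sup>+" "\<And>i. i \<in> {1..n} \<Longrightarrow> e i \<le> n"
  shows "1 \<le> i \<and> i \<le> n \<and> R i < j \<and> i < j \<and> j \<le> n"
  using assms(1)
proof induction
  case (base j)
  thus ?case using R_ge[of i] assms(2)[of i] by (auto simp: below_def)
next
  case (step x j)
  thus ?case using R_ge[of x] assms(2)[of x] by (auto simp: below_def)
qed

text \<open>A position \<open>j\<close> past \<open>R i\<close> lies in the run of \<open>i\<close>.
  Otherwise \<open>j\<close> is in the region of \<open>i\<close> and is the outer bracket of the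
  two, so its run contains that of \<open>i\<close>, hence also \<open>k\<close>.\<close>

lemma below_cotrans:
  assumes "nested_on {1..n} R e" "\<And>i. i \<in> {1..n} \<Longrightarrow> e i \<le> n"
    and "(i, k) \<in> below e" "i < j" "j < k"
  shows "(i, j) \<in> below e \<or> (j, k) \<in> below e"
proof (cases "R i < j")
  case True
  thus ?thesis using assms by (auto simp: below_def)
next
  case False
  have i: "1 \<le> i" "i \<le> n" "R i < k" "k \<le> e i" using assms(3) by (auto simp: below_def)
  have j: "j \<in> {1..n}" using assms(2)[of i] assms(4,5) i by simp
  have "R j = R i" using False R_const[of i j] i assms(4) by simp
  moreover have "R j \<le> e j" using assms(1) j by (simp add: nested_on_def)
  ultimately have "e i \<le> e j" using assms(1,4) i j unfolding nested_on_def
    by (metis atLeastAtMost_iff)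
  thus ?thesis using \<open>R j = R i\<close> i j by (simp add: below_def)
qed

text \<open>Along a chain, \<open>j\<close> either falls before or on the last intermediate
  position, or is skipped by the last link, where \<open>below_cotrans\<close> applies.\<close>

lemma trancl_below_cotrans:
  assumes e: "nested_on {1..n} R e" "\<And>i. i \<in> {1..n} \<Longrightarrow> e i \<le> n"
    and "(i, k) \<in> (below e)\<^sup>+" "i < j" "j < k"
  shows "(i, j) \<in> (below e)\<^sup>+ \<or> (j, k) \<in> (below e)\<^sup>+"
  using assms(3-5)
proof induction
  case (base k)
  thus ?case using below_cotrans[OF e] by blast
next
  case (step x k)
  consider "j < x" | "j = x" | "x < j" by linarith
  thus ?case
  proof cases
    case 1
    thus ?thesis using step by (meson trancl_into_trancl)
  next
    case 2
    thus ?thesis using step by simp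
  next
    case 3
    thus ?thesis using step below_cotrans[OF e step.hyps(2)] by (meson r_into_trancl trancl_into_trancl)
  qed
qed

text \<open>The permutation is the one whose inversion set is the transitive closure of
  \<open>below e\<close>. Avoidance and the values of \<open>reach\<close> are then read off from
  the last link of a chain.\<close>

lemma exists_reach_eq:
  assumes e: "nested_on {1..n} R e" "\<And>i. i \<in> {1..n} \<Longrightarrow> e i \<le> n"
  shows "\<exists>w. increasing w \<and> avoiding w \<and> (\<forall>i\<in>{1..n}. reach w i = e i)"
proof -
  note bounds = trancl_below_bounds[OF _ e(2)]
  have "(below e)\<^sup>+ \<subseteq> {(i, j). 1 \<le> i \<and> i < j \<and> j \<le> n}" using bounds by fastforce
  hence "\<exists>w. w permutes {1..n} \<and> Inv n w = (below e)\<^sup>+"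
    by (rule permutation_with_inversions[OF _ trans_trancl trancl_below_cotrans[OF e]])
  then obtain w where w: "w permutes {1..n}" and Inv: "Inv n w = (below e)\<^sup>+"
    by blast
  note inj = permutes_inj[OF w, THEN injD]
  have inverted: "w j < w i" if "(i, j) \<in> (below e)\<^sup>+" for i j
    using that unfolding Inv[symmetric] Inv_iff by blast
  have below_inverted: "w j < w i" if "i \<in> {1..n}" "R i < j" "j \<le> e i" for i j
    using that by (intro inverted r_into_trancl) (simp add: below_def)
  have inc: "increasing w"
    unfolding increasing_def
  proof (intro conjI allI impI w)
    fix i j assume ij: "1 \<le> i \<and> i < j \<and> j \<le> n \<and> R i = R j"
    hence "(i, j) \<notin> (below e)\<^sup>+" using bounds[of i j] R_ge[of j] by auto
    hence "\<not> w j < w i" using ij unfolding Inv[symmetric] Inv_iff by blast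
    moreover have "w i \<noteq> w j" using inj[of i j] ij by auto
    ultimately show "w i < w j" by simp
  qed
  moreover have "avoiding w"
    unfolding avoiding_def
  proof (intro allI impI notI)
    fix i j k
    assume ijk: "1 \<le> i \<and> i < j \<and> j < k \<and> k \<le> n \<and> R i \<noteq> R j \<and> R j \<noteq> R k \<and> w i < w j"
      and adj: "w i = w k + 1"
    have "(i, k) \<in> (below e)\<^sup>+" using ijk adj by (simp flip: Inv add: Inv_iff)
    \<comment> \<open>A chain through a further position \<open>x\<close> would place
      \<open>w x\<close> strictly between the consecutive values \<open>w k\<close> and
      \<open>w i\<close>.\<close>
    hence "(i, k) \<in> below e"
    proof (cases rule: tranclE)
      case (step x)
      hence "w x < w i" "w k < w x" by (auto intro: inverted)
      thus ?thesis using adj by simp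
    qed
    moreover have "R i < j" using R_mono[of i j] R_less_iff[of i j] ijk by simp
    ultimately have "w j < w i" using ijk by (intro below_inverted) (auto simp: below_def)
    thus False using ijk by simp
  qed
  moreover have "reach w i = e i" if i: "i \<in> {1..n}" for i
  proof (rule reach_eqI)
    show "e i \<in> reach_set w i"
      using i e below_inverted by (auto simp: reach_set_def nested_on_def)
    assume "e i < n"
    \<comment> \<open>The last link of such a chain would start at an \<open>x\<close> that opens
      inside \<open>i\<close> and closes after it, against nestedness.\<close>
    have "(i, e i + 1) \<notin> (below e)\<^sup>+"
    proof
      assume "(i, e i + 1) \<in> (below e)\<^sup>+"
      thus False
      proof (cases rule: tranclE)
        case base
        thus False by (simp add: below_def)
      next
        case (step x)
        hence x: "1 \<le> x" "x \<le> n" "R x \<le> e i" "e i < e x" by (auto simp: below_def)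
        have "R i < R x" using bounds[OF step(1)] R_less_iff[of i x] by simp
        hence "e x \<le> e i" using e(1) i x by (simp add: nested_on_def)
        thus False using x by simp
      qed
    qed
    hence "\<not> (1 \<le> i \<and> i < e i + 1 \<and> e i + 1 \<le> n \<and> w (e i + 1) < w i)"
      unfolding Inv[symmetric] Inv_iff .
    moreover have "i \<le> R i" "R i \<le> e i" using e(1) i R_ge[of i] by (simp_all add: nested_on_def)
    ultimately show "w i \<le> w (e i + 1)" using i \<open>e i < n\<close> by auto
  qed
  ultimately show ?thesis by blast
qed

end

subsection \<open>Heights of the east steps of a path\<close>

fun east_heights :: "path \<Rightarrow> nat list" where
  "east_heights [] = []"
| "east_heights (East # p) = 0 # east_heights p"
| "east_heights (North # p) = map Suc (east_heights p)"

lemma length_east_heights [simp]: "length (east_heights p) = count_list p East"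
  by (induction p rule: east_heights.induct) auto

lemma east_heights_append:
  "east_heights (p @ q) = east_heights p @ map (\<lambda>h. h + count_list p North) (east_heights q)"
  by (induction p rule: east_heights.induct) auto

lemma east_heights_le: "h \<in> set (east_heights p) \<Longrightarrow> h \<le> count_list p North"
  by (induction p arbitrary: h rule: east_heights.induct) auto

lemma sorted_east_heights: "sorted (east_heights p)"
  by (induction p rule: east_heights.induct) (auto simp: sorted_map intro: sorted_wrt_mono_rel)

lemma path_eqI_heights:
  "count_list p North = count_list q North \<Longrightarrow> east_heights p = east_heights q \<Longrightarrow> p = q"
proof (induction p arbitrary: q rule: east_heights.induct)
  case 1
  thus ?case by (cases q rule: east_heights.cases) auto
next
  case (2 p)
  thus ?case by (cases q rule: east_heights.cases) auto
next
  case (3 p)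
  show ?case
  proof (cases q rule: east_heights.cases)
    case 1
    thus ?thesis using 3 by auto
  next
    case (2 q')
    thus ?thesis using 3 by (auto simp: Cons_eq_map_conv map_eq_Cons_conv)
  next
    case (3 q')
    thus ?thesis using "3.prems" "3.IH"[of q'] by auto
  qed
qed

text \<open>East heights are listed in increasing order along a path, so their multiset already
  determines the list.\<close>

lemma path_eqI:
  assumes "count_list p North = count_list q North" "mset (east_heights p) = mset (east_heights q)"
  shows "p = q"
  using assms sorted_east_heights path_eqI_heights properties_for_sort sorted_sort_id by metis

text \<open>The abscissa of the leftmost point at height \<open>y\<close>. The rightmost point at
  height \<open>y\<close> has abscissa \<open>cum_width p (Suc y)\<close>, also at the top height,
  where this is the full width.\<close>

definition cum_width :: "path \<Rightarrow> nat \<Rightarrow> nat" where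
  "cum_width p y = size {#h \<in># mset (east_heights p). h < y#}"

lemma cum_width_mono: "y \<le> y' \<Longrightarrow> cum_width p y \<le> cum_width p y'"
  unfolding cum_width_def by (intro size_mset_mono filter_mset_mono_strong) auto

lemma cum_width_le: "cum_width p y \<le> count_list p East"
  unfolding cum_width_def using size_filter_mset_lesseq[of _ "mset (east_heights p)"] by simp

lemma length_path: "count_list p East + count_list p North = length p"
  by (induction p rule: east_heights.induct) auto

text \<open>Cut the path at the point: east steps before it have height at most \<open>y\<close>,
  those after it height at least \<open>y\<close>.\<close>

lemma path_point_bounds:
  assumes "k \<le> length p" "path_point p k = (x, y)"
  shows "cum_width p y \<le> x" "x \<le> cum_width p (Suc y)" "y \<le> count_list p North" "x + y = k"
proof -
  define a b where "a = take k p" and "b = drop k p"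
  have p: "p = a @ b" by (simp add: a_def b_def)
  have xy: "x = count_list a East" "y = count_list a North"
    using assms(2) by (auto simp: path_point_def a_def)
  have le: "h \<le> y" if "h \<in> set (east_heights a)" for h using east_heights_le[OF that] xy by simp
  have split: "cum_width p z = size {#h \<in># mset (east_heights a). h < z#}
      + size {#h \<in># mset (map (\<lambda>h. h + y) (east_heights b)). h < z#}" for z
    by (simp add: cum_width_def p east_heights_append xy)
  have "{#h \<in># mset (map (\<lambda>h. h + y) (east_heights b)). h < y#} = {#}"
    by (simp add: filter_mset_eq_conv)
  hence "cum_width p y = size {#h \<in># mset (east_heights a). h < y#}" by (simp add: split)
  also have "\<dots> \<le> x" using size_filter_mset_lesseq[of _ "mset (east_heights a)"] by (simp add: xy)
  finally show "cum_width p y \<le> x" .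
  have "{#h \<in># mset (east_heights a). h < Suc y#} = mset (east_heights a)"
    using le by (auto simp: filter_mset_eq_conv less_Suc_eq_le)
  thus "x \<le> cum_width p (Suc y)" by (simp add: split xy)
  show "y \<le> count_list p North" by (simp add: p xy)
  show "x + y = k" using length_path[of a] assms(1) by (simp add: xy a_def)
qed

text \<open>Each step raises the sum of the coordinates by one, so only position
  \<open>x + y\<close> is possible; a point there at another height would violate
  \<open>path_point_bounds\<close>.\<close>

lemma path_point_eqI:
  assumes "cum_width p y \<le> x" "x \<le> cum_width p (Suc y)" "y \<le> count_list p North"
  shows "x + y \<le> length p" "path_point p (x + y) = (x, y)"
proof -
  show le: "x + y \<le> length p" using assms cum_width_le[of p "Suc y"] length_path[of p] by simp
  obtain x' y' where xy': "path_point p (x + y) = (x', y')" by fastforce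
  note b = path_point_bounds[OF le xy']
  have "\<not> y' < y" using cum_width_mono[of "Suc y'" y p] assms b by auto
  moreover have "\<not> y < y'" using cum_width_mono[of "Suc y" y' p] assms b by auto
  ultimately show "path_point p (x + y) = (x, y)" using xy' b by auto
qed

lemma path_points_eq:
  "path_points p =
     {(x, y). y \<le> count_list p North \<and> cum_width p y \<le> x \<and> x \<le> cum_width p (Suc y)}"
proof (intro equalityI subsetI)
  fix z assume "z \<in> path_points p"
  then obtain k where k: "k \<le> length p" "z = path_point p k" by (auto simp: path_points_def)
  moreover obtain x y where "z = (x, y)" by fastforce
  ultimately show "z \<in> {(x, y). y \<le> count_list p North \<and> cum_width p y \<le> x \<and> x \<le> cum_width p (Suc y)}"
    using path_point_bounds[of k p x y] by auto
next
  fix z assume "z \<in> {(x, y). y \<le> count_list p North \<and> cum_width p y \<le> x \<and> x \<le> cum_width p (Suc y)}"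
  then obtain x y where "z = (x, y)" "y \<le> count_list p North" "cum_width p y \<le> x" "x \<le> cum_width p (Suc y)"
    by auto
  thus "z \<in> path_points p" using path_point_eqI[of p y x] by (force simp: path_points_def)
qed

lemma path_end_eq: "path_end p = (count_list p East, count_list p North)"
  by (simp add: path_end_def path_point_def)

lemma cum_width_0 [simp]: "cum_width p 0 = 0"
  by (simp add: cum_width_def)

text \<open>It suffices to compare the rightmost points at each height.\<close>

lemma never_below_iff:
  assumes "count_list p North = count_list q North"
  shows "never_below p q \<longleftrightarrow> (\<forall>y \<le> count_list p North. cum_width p (Suc y) \<le> cum_width q (Suc y))"
proof
  assume nb: "never_below p q"
  show "\<forall>y \<le> count_list p North. cum_width p (Suc y) \<le> cum_width q (Suc y)"
  proof (intro allI impI)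
    fix y assume "y \<le> count_list p North"
    hence "(cum_width p (Suc y), y) \<in> path_points p"
      by (simp add: path_points_eq cum_width_mono)
    then obtain y' where "(cum_width p (Suc y), y') \<in> path_points q" "y' \<le> y"
      using nb by (auto simp: never_below_def)
    thus "cum_width p (Suc y) \<le> cum_width q (Suc y)"
      using cum_width_mono[of "Suc y'" "Suc y" q] by (auto simp: path_points_eq)
  qed
next
  assume le: "\<forall>y \<le> count_list p North. cum_width p (Suc y) \<le> cum_width q (Suc y)"
  show "never_below p q"
    unfolding never_below_def
  proof (intro allI impI)
    fix x y assume "(x, y) \<in> path_points p"
    hence xy: "y \<le> count_list p North" "x \<le> cum_width q (Suc y)"
      using le by (fastforce simp: path_points_eq)+
    \<comment> \<open>The lowest height at which \<open>q\<close> gets as far as \<open>x\<close>;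
      by minimality its leftmost point there is not beyond \<open>x\<close>.\<close>
    define y' where "y' = (LEAST z. x \<le> cum_width q (Suc z))"
    have y': "x \<le> cum_width q (Suc y')" "y' \<le> y"
      unfolding y'_def using xy by (auto intro: LeastI Least_le)
    have "cum_width q y' \<le> x"
    proof (cases y')
      case (Suc z)
      thus ?thesis using not_less_Least[of z "\<lambda>z. x \<le> cum_width q (Suc z)"] by (simp add: y'_def)
    qed simp
    thus "\<exists>y'. (x, y') \<in> path_points q \<and> y' \<le> y"
      using y' xy assms by (auto simp: path_points_eq intro!: exI[of _ y'])
  qed
qed

lemma horiz_eq:
  assumes "y \<le> count_list q North"
  shows "horiz q (x, y) = int (cum_width q (Suc y)) - int x"
proof -
  have "{x. (x, y) \<in> path_points q} = {cum_width q y..cum_width q (Suc y)}"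
    using assms by (auto simp: path_points_eq)
  moreover have "Max {cum_width q y..cum_width q (Suc y)} = cum_width q (Suc y)"
    by (rule Max_eqI) (auto simp: cum_width_mono)
  ultimately show ?thesis by (simp add: horiz_def)
qed

section \<open>East heights of a path given by its list of widths\<close>

lemma count_list_replicate: "count_list (replicate k x) y = (if x = y then k else 0)"
  by (induction k) auto

lemma east_heights_replicate [simp]:
  "east_heights (replicate k East) = replicate k 0" "east_heights (replicate k North) = []"
  by (induction k) auto

lemma path_of_Cons_Cons: "path_of (a # b # as) = replicate a East @ North # path_of (b # as)"
  by simp

lemma count_list_path_of: "fs \<noteq> [] \<Longrightarrow> count_list (path_of fs) North = length fs - 1"
proof (induction fs rule: induct_list012)
  case (3 a b as)
  thus ?case unfolding path_of_Cons_Cons by (simp add: count_list_replicate del: path_of.simps)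
qed (auto simp: count_list_replicate)

lemma count_east_heights_path_of:
  "count (mset (east_heights (path_of fs))) h = (if h < length fs then fs ! h else 0)"
proof (induction fs arbitrary: h rule: induct_list012)
  case (2 a)
  thus ?case by (cases h) auto
next
  case (3 a b as)
  show ?case
  proof (cases h)
    case 0
    thus ?thesis unfolding path_of_Cons_Cons
      by (simp add: east_heights_append count_list_replicate count_image_mset vimage_def del: path_of.simps)
  next
    case (Suc h')
    have "count (image_mset Suc M) (Suc h') = count M h'" for M :: "nat multiset"
      by (induction M) auto
    thus ?thesis unfolding path_of_Cons_Cons using "3.IH"(2)[of h'] Suc
      by (simp add: east_heights_append count_list_replicate del: path_of.simps)
  qed
qed simp

section \<open>Valleys and rotations in terms of heights\<close>

lemma path_point_Suc:
  assumes "k < length p" "path_point p k = (x, y)"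
  shows "path_point p (Suc k) = (if p ! k = East then (Suc x, y) else (x, Suc y))"
  using assms by (cases "p ! k") (auto simp: path_point_def take_Suc_conv_app_nth)

lemma valley_decomp:
  assumes "is_valley p k"
  obtains a b where "p = a @ East # North # b" "k = Suc (length a)"
proof
  have k: "0 < k" "k < length p" "p ! (k - 1) = East" "p ! k = North"
    using assms by (auto simp: is_valley_def)
  have "p = take (k - 1) p @ p ! (k - 1) # drop (Suc (k - 1)) p" using k by (intro id_take_nth_drop) simp
  also have "drop (Suc (k - 1)) p = p ! k # drop (Suc k) p" 
    using Cons_nth_drop_Suc[OF k(2)] k(1) by simp
  finally show "p = take (k - 1) p @ East # North # drop (Suc k) p" using k by simp
  show "k = Suc (length (take (k - 1) p))" using k by simp
qed

text \<open>The north step after a valley makes it the rightmost point at its height, so the height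
  determines the valley.\<close>

lemma valley_point:
  assumes "is_valley p k" "path_point p k = (x, h)"
  shows "h < count_list p North" "x = cum_width p (Suc h)" "h \<in> set (east_heights p)"
proof -
  obtain a b where p: "p = a @ East # North # b" "k = Suc (length a)"
    using assms(1) by (rule valley_decomp)
  have xh: "x = Suc (count_list a East)" "h = count_list a North"
    using assms(2) by (auto simp: p path_point_def)
  show "h < count_list p North" "h \<in> set (east_heights p)"
    by (simp_all add: p xh east_heights_append)
  have "k < length p" by (simp add: p)
  moreover have "p ! k = North" using assms(1) by (simp add: is_valley_def)
  ultimately have "path_point p (Suc k) = (x, Suc h)"
    using path_point_Suc[of k p] assms(2) by simp
  hence "cum_width p (Suc h) \<le> x" using path_point_bounds(1)[of "Suc k" p] \<open>k < length p\<close> by simp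
  moreover have "x \<le> cum_width p (Suc h)"
    using path_point_bounds(2)[of k p] \<open>k < length p\<close> assms(2) by simp
  ultimately show "x = cum_width p (Suc h)" by simp
qed

lemma cum_width_less:
  assumes "h \<in> set (east_heights p)"
  shows "cum_width p h < cum_width p (Suc h)"
proof -
  have "{#l \<in># mset (east_heights p). l < h#} \<subset># {#l \<in># mset (east_heights p). l < Suc h#}"
  proof (rule subset_mset.le_neq_trans)
    show "{#l \<in># mset (east_heights p). l < h#} \<subseteq># {#l \<in># mset (east_heights p). l < Suc h#}"
      by (rule filter_mset_mono_strong) auto
    have "h \<in># {#l \<in># mset (east_heights p). l < Suc h#}" "h \<notin># {#l \<in># mset (east_heights p). l < h#}"
      using assms by auto
    thus "{#l \<in># mset (east_heights p). l < h#} \<noteq> {#l \<in># mset (east_heights p). l < Suc h#}"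
      by metis
  qed
  thus ?thesis unfolding cum_width_def by (rule mset_subset_size)
qed

text \<open>Take the rightmost point at height \<open>h\<close>: the step before it is east because
  some east step has height \<open>h\<close>, the step after it is north because the path goes on
  but not to the right.\<close>

lemma valley_exists:
  assumes "h < count_list p North" "h \<in> set (east_heights p)"
  obtains k x where "is_valley p k" "path_point p k = (x, h)"
proof -
  define x where "x = cum_width p (Suc h)"
  have "cum_width p h < x" using cum_width_less[OF assms(2)] by (simp add: x_def)
  then obtain x' where x': "x = Suc x'" "cum_width p h \<le> x'" by (cases x) auto
  note pt = path_point_eqI[of p h x] and pt' = path_point_eqI[of p h x']
  have k: "x + h \<le> length p" "path_point p (x + h) = (x, h)"
    using pt assms(1) cum_width_mono[of h "Suc h" p] by (auto simp: x_def)
  have k': "path_point p (x' + h) = (x', h)" using pt' x' assms(1) by (simp add: x_def)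
  have "p ! (x' + h) = East"
    using path_point_Suc[OF _ k'] k x' by (auto split: if_splits)
  moreover have less: "x + h < length p"
    using k assms(1) by (cases "x + h = length p") (auto simp: path_point_def)
  moreover have "p ! (x + h) = North"
  proof (cases "p ! (x + h)")
    case East
    hence "path_point p (Suc (x + h)) = (Suc x, h)" using path_point_Suc[OF less k(2)] by simp
    thus ?thesis using path_point_bounds(2)[of "Suc (x + h)" p] less by (simp add: x_def)
  qed
  ultimately have "is_valley p (x + h)" by (simp add: is_valley_def x')
  thus ?thesis using that k(2) by blast
qed

text \<open>Moving the east step past the segment leaves the number of north steps before every
  other step unchanged; only the moved step changes height, from \<open>h\<close> to
  \<open>v\<close>. Adding an element on both sides avoids multiset subtraction.\<close>

lemma rotation_heights:
  assumes "is_valley p k" "path_point p k = (x, h)" "path_point p j = (x', v)"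
    and "next_same_horiz \<nu> p k = j" "k < j" "j \<le> length p"
  shows "count_list (rotation \<nu> p k) North = count_list p North"
    and "add_mset h (mset (east_heights (rotation \<nu> p k))) = add_mset v (mset (east_heights p))"
proof -
  obtain a q where p: "p = a @ East # q" and k: "k = Suc (length a)"
    using valley_decomp[OF assms(1)] by metis
  define b c where "b = take (j - k) q" and "c = drop (j - k) q"
  have q: "q = b @ c" by (simp add: b_def c_def)
  have drop_k: "drop k p = q" by (simp add: p k)
  have drop_j: "drop j p = c"
    using drop_drop[of "j - k" k p] assms(5) by (simp add: drop_k c_def)
  have rot: "rotation \<nu> p k = a @ b @ [East] @ c"
    by (simp add: rotation_def Let_def assms(4) drop_k drop_j flip: b_def) (simp add: p k)
  have take_j: "take j p = a @ East # b"
  proof -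
    obtain d where "j = k + d" using assms(5) less_imp_add_positive by blast
    thus ?thesis by (simp add: p k b_def)
  qed
  have h: "h = count_list a North" using assms(2) by (simp add: path_point_def p k)
  have v: "v = h + count_list b North" using assms(3) by (simp add: path_point_def take_j h)
  show "count_list (rotation \<nu> p k) North = count_list p North"
    unfolding rot by (simp add: p q)
  show "add_mset h (mset (east_heights (rotation \<nu> p k))) = add_mset v (mset (east_heights p))"
    unfolding rot by (simp add: p q east_heights_append v h comp_def ac_simps)
qed

subsection \<open>Rotations and nested families\<close>

text \<open>Each index \<open>i\<close> accounts for one east step of \<open>\<nu>\<close> at height
  \<open>R i\<close>: in the family of \<open>\<nu>\<close> every bracket closes where it
  opens.\<close>

locale bounce = regions +
  fixes \<nu> :: path
  assumes north: "count_list \<nu> North = n"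
    and heights: "mset (east_heights \<nu>) = image_mset R (mset_set {1..n})"
begin

definition closing :: "(nat \<Rightarrow> nat) \<Rightarrow> bool" where
  "closing e \<longleftrightarrow> nested_on {1..n} R e \<and> (\<forall>i\<in>{1..n}. e i \<le> n)"

definition represents :: "path \<Rightarrow> (nat \<Rightarrow> nat) \<Rightarrow> bool" where
  "represents \<mu> e \<longleftrightarrow> count_list \<mu> North = n \<and>
     mset (east_heights \<mu>) = image_mset e (mset_set {1..n})"

text \<open>By \<open>cum_width_Suc\<close> this is the abscissa of the rightmost point at height
  \<open>y\<close> on a path represented by \<open>e\<close>. Thus \<open>closed R y\<close> is that
  of \<open>\<nu>\<close> and counts the brackets opened up to \<open>y\<close>.\<close>

definition closed :: "(nat \<Rightarrow> nat) \<Rightarrow> nat \<Rightarrow> nat" where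
  "closed e y = card {i \<in> {1..n}. e i \<le> y}"

lemma closing_R_le: "closing e \<Longrightarrow> i \<in> {1..n} \<Longrightarrow> R i \<le> e i"
  and closing_le: "closing e \<Longrightarrow> i \<in> {1..n} \<Longrightarrow> e i \<le> n"
  and closing_nested: "closing e \<Longrightarrow> i \<in> {1..n} \<Longrightarrow> j \<in> {1..n} \<Longrightarrow>
     R i < R j \<or> R i = R j \<and> j < i \<Longrightarrow> R j \<le> e i \<Longrightarrow> e j \<le> e i"
  unfolding closing_def nested_on_def by blast+

lemma represents_\<nu>: "represents \<nu> R"
  by (simp add: represents_def north heights)

lemma cum_width_represents:
  assumes "represents \<mu> e"
  shows "cum_width \<mu> y = card {i \<in> {1..n}. e i < y}"
  using assms by (simp add: represents_def cum_width_def filter_mset_image_mset)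

lemma cum_width_Suc: "represents \<mu> e \<Longrightarrow> cum_width \<mu> (Suc y) = closed e y"
  by (simp add: cum_width_represents closed_def less_Suc_eq_le)

lemma represents_unique: "represents \<mu> e \<Longrightarrow> represents \<mu>' e \<Longrightarrow> \<mu> = \<mu>'"
  by (rule path_eqI) (simp_all add: represents_def)

lemma represents_cong:
  assumes "\<And>i. i \<in> {1..n} \<Longrightarrow> e i = e' i"
  shows "represents \<mu> e \<longleftrightarrow> represents \<mu> e'"
proof -
  have "image_mset e (mset_set {1..n}) = image_mset e' (mset_set {1..n})"
    using assms by (intro image_mset_cong) auto
  thus ?thesis by (simp add: represents_def)
qed

lemma represents_east: "represents \<mu> e \<Longrightarrow> count_list \<mu> East = n"
  by (simp add: represents_def flip: length_east_heights size_mset)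

lemma paths_above_iff:
  "\<mu> \<in> paths_above \<nu> \<longleftrightarrow> count_list \<mu> North = n \<and> count_list \<mu> East = n \<and>
     (\<forall>y\<le>n. cum_width \<mu> (Suc y) \<le> closed R y)"
proof -
  have "path_end \<mu> = path_end \<nu> \<longleftrightarrow> count_list \<mu> North = n \<and> count_list \<mu> East = n"
    using represents_east[OF represents_\<nu>] north by (auto simp: path_end_eq)
  thus ?thesis
    using never_below_iff[of \<mu> \<nu>] cum_width_Suc[OF represents_\<nu>] north
    by (auto simp: paths_above_def)
qed

lemma represents_above:
  assumes "closing e" "represents \<mu> e"
  shows "\<mu> \<in> paths_above \<nu>"
proof -
  have "closed e y \<le> closed R y" for y
    unfolding closed_def
    using closing_R_le[OF assms(1)] by (intro card_mono) (auto intro: order_trans)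
  thus ?thesis
    using assms(2) represents_east[OF assms(2)]
    by (simp add: paths_above_iff cum_width_Suc[OF assms(2)]) (simp add: represents_def)
qed

text \<open>For heights up to \<open>n\<close>, staying above \<open>\<nu>\<close> is exactly the
  counting hypothesis of \<open>nested_on_exists\<close>; beyond \<open>n\<close> all brackets have
  opened.\<close>

lemma above_represented:
  assumes "\<mu> \<in> paths_above \<nu>"
  obtains e where "closing e" "represents \<mu> e"
proof -
  define M where "M = mset (east_heights \<mu>)"
  have \<mu>: "count_list \<mu> North = n" "count_list \<mu> East = n"
    "\<And>y. y \<le> n \<Longrightarrow> cum_width \<mu> (Suc y) \<le> closed R y"
    using assms by (auto simp: paths_above_iff)
  have "size {#x \<in># M. x \<le> h#} \<le> card {i \<in> {1..n}. R i \<le> h}" for h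
  proof (cases "h \<le> n")
    case True
    thus ?thesis using \<mu>(3)[of h] by (simp add: M_def closed_def cum_width_def less_Suc_eq_le)
  next
    case False
    hence "{i \<in> {1..n}. R i \<le> h} = {1..n}" using R_le by force
    thus ?thesis using size_filter_mset_lesseq[of _ M] \<mu>(2) by (simp add: M_def)
  qed
  moreover have "size M = card {1..n}" using \<mu>(2) by (simp add: M_def)
  ultimately obtain e where e: "nested_on {1..n} R e" "image_mset e (mset_set {1..n}) = M"
    using nested_on_exists[of "{1..n}" M R] by auto
  have "e i \<le> n" if "i \<in> {1..n}" for i
  proof -
    have "e i \<in># M" using that by (simp flip: e(2))
    thus ?thesis using east_heights_le[of "e i" \<mu>] \<mu>(1) by (simp add: M_def)
  qed
  hence "closing e" using e(1) by (simp add: closing_def)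
  moreover have "represents \<mu> e" using e(2) \<mu>(1) by (simp add: represents_def M_def)
  ultimately show ?thesis by (rule that)
qed

lemma closing_unique:
  assumes "closing e" "closing e'" "represents \<mu> e" "represents \<mu> e'" "i \<in> {1..n}"
  shows "e i = e' i"
proof -
  have "image_mset e (mset_set {1..n}) = image_mset e' (mset_set {1..n})"
    using assms by (simp add: represents_def)
  thus ?thesis using assms nested_on_unique[of "{1..n}" R e e' i] by (simp add: closing_def)
qed

text \<open>The height to which a rotation lifts an east step at height \<open>h\<close>: all the indices that open
  at \<open>h + 1\<close> have to be closed again.\<close>

definition lift :: "(nat \<Rightarrow> nat) \<Rightarrow> nat \<Rightarrow> nat" where
  "lift e h = (if R (h + 1) = h + 1 then e (h + 1) else h + 1)"

context
  fixes e h
  assumes e: "closing e" and h: "h < n"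
begin

lemma lift_bounds: "h < lift e h" "lift e h \<le> n"
  using closing_R_le[OF e, of "h + 1"] closing_le[OF e, of "h + 1"] h by (auto simp: lift_def)

text \<open>If a region ends at \<open>h + 1\<close>, the index \<open>h + 1\<close> is the
  outermost of all brackets that open above \<open>h\<close>, and it encloses the others that open
  before it closes. If none ends there, no bracket opens at \<open>h + 1\<close>.\<close>

lemma le_lift:
  assumes "i \<in> {1..n}" "h < R i" "R i \<le> lift e h"
  shows "e i \<le> lift e h"
proof (cases "R (h + 1) = h + 1")
  case True
  have s: "h + 1 \<in> {1..n}" using h by simp
  have "i = h + 1 \<or> R (h + 1) < R i \<or> R (h + 1) = R i \<and> i < h + 1"
    using assms True R_ge[of i] by force
  thus ?thesis using closing_nested[OF e s assms(1)] assms(3) True by (auto simp: lift_def)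
next
  case False
  thus ?thesis using assms R_R[of i] by (simp add: lift_def le_Suc_eq)
qed

text \<open>A bracket that opens by height \<open>h\<close> and is still open after \<open>h\<close>
  encloses the index \<open>h + 1\<close> if a region ends there. Allowing a second family
  \<open>e'\<close> serves the comparison of two paths later.\<close>

lemma lift_le:
  assumes "closing e'" "e (h + 1) \<le> e' (h + 1)" "i \<in> {1..n}" "R i \<le> h" "h < e' i"
  shows "lift e h \<le> e' i"
proof (cases "R (h + 1) = h + 1")
  case True
  have "e' (h + 1) \<le> e' i"
    using assms True h by (intro closing_nested[OF assms(1)]) auto
  thus ?thesis using assms True by (simp add: lift_def)
qed (use assms in \<open>simp add: lift_def\<close>)

lemma closed_add: "h \<le> y \<Longrightarrow> closed f y = closed f h + card {i \<in> {1..n}. h < f i \<and> f i \<le> y}"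
  unfolding closed_def
  by (subst card_Un_disjoint[symmetric]) (auto intro!: arg_cong[where f = card])

text \<open>Strictly between \<open>h\<close> and the lift, the bracket \<open>h + 1\<close> has
  opened but not closed, while everything closing there also opened above \<open>h\<close>. So on
  these heights \<open>horiz\<close> exceeds its value at the valley.\<close>

lemma closed_less_lift:
  assumes "h < y" "y < lift e h"
  shows "closed R h + closed e y < closed R y + closed e h"
proof -
  have s: "R (h + 1) = h + 1" "lift e h = e (h + 1)"
    using assms by (auto simp: lift_def split: if_splits)
  have "{i \<in> {1..n}. h < e i \<and> e i \<le> y} \<subseteq> {i \<in> {1..n}. h < R i \<and> R i \<le> y}"
  proof clarify
    fix i assume i: "i \<in> {1..n}" "h < e i" "e i \<le> y"
    thus "h < R i \<and> R i \<le> y"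
      using lift_le[OF e, of i] closing_R_le[OF e i(1)] assms(2) by (auto simp: not_less[symmetric] simp del: not_less)
  qed
  moreover have "h + 1 \<in> {i \<in> {1..n}. h < R i \<and> R i \<le> y}" "h + 1 \<notin> {i \<in> {1..n}. h < e i \<and> e i \<le> y}"
    using s assms h by auto
  ultimately have "{i \<in> {1..n}. h < e i \<and> e i \<le> y} \<subset> {i \<in> {1..n}. h < R i \<and> R i \<le> y}" by blast
  hence "card {i \<in> {1..n}. h < e i \<and> e i \<le> y} < card {i \<in> {1..n}. h < R i \<and> R i \<le> y}"
    by (intro psubset_card_mono) auto
  thus ?thesis using assms(1) by (simp add: closed_add[of y])
qed

text \<open>With \<open>closed_lift_lower\<close>, this shows that at height \<open>lift e h\<close>
  the value of \<open>horiz\<close> at the valley lies between those at the rightmost and leftmost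
  points of the path, hence is attained.\<close>

lemma closed_lift_upper: "closed R (lift e h) + closed e h \<le> closed e (lift e h) + closed R h"
proof -
  have "card {i \<in> {1..n}. h < R i \<and> R i \<le> lift e h} \<le> card {i \<in> {1..n}. h < e i \<and> e i \<le> lift e h}"
    using le_lift closing_R_le[OF e] by (intro card_mono) (auto intro: less_le_trans)
  thus ?thesis using lift_bounds by (simp add: closed_add[of "lift e h"])
qed

lemma closed_lift_lower:
  "card {i \<in> {1..n}. e i < lift e h} + closed R h \<le> closed R (lift e h) + closed e h"
proof -
  have "card {i \<in> {1..n}. e i < lift e h}
      = closed e h + card {i \<in> {1..n}. h < e i \<and> e i < lift e h}"
    unfolding closed_def using lift_bounds(1)
    by (subst card_Un_disjoint[symmetric]) (auto intro!: arg_cong[where f = card])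
  moreover have "card {i \<in> {1..n}. h < e i \<and> e i < lift e h}
      \<le> card {i \<in> {1..n}. h < R i \<and> R i \<le> lift e h}"
  proof (intro card_mono subsetI)
    fix i assume "i \<in> {i \<in> {1..n}. h < e i \<and> e i < lift e h}"
    hence i: "i \<in> {1..n}" "h < e i" "e i < lift e h" by auto
    have "h < R i" using lift_le[OF e _ i(1)] i by force
    thus "i \<in> {i \<in> {1..n}. h < R i \<and> R i \<le> lift e h}" using i closing_R_le[OF e i(1)] by auto
  qed auto
  ultimately show ?thesis using lift_bounds by (simp add: closed_add[of "lift e h"])
qed

text \<open>Brackets inside \<open>i\<close> stay inside by \<open>le_lift\<close>. Brackets around
  \<open>i\<close> close strictly after \<open>h\<close>, since \<open>i\<close> is outermost among
  those closing at \<open>h\<close>, and hence not before the lift by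
  \<open>lift_le\<close>.\<close>

lemma closing_lift:
  assumes i: "i \<in> {1..n}" "e i = h"
    and outermost: "\<And>j. j \<in> {1..n} \<Longrightarrow> e j = h \<Longrightarrow> R i < R j \<or> R i = R j \<and> j \<le> i"
  shows "closing (e(i := lift e h))"
  unfolding closing_def nested_on_def
proof (intro conjI ballI impI)
  fix j assume "j \<in> {1..n}"
  thus "R j \<le> (e(i := lift e h)) j" "(e(i := lift e h)) j \<le> n"
    using lift_bounds closing_R_le[OF e] closing_le[OF e] i by force+
next
  fix j k assume jk: "j \<in> {1..n}" "k \<in> {1..n}" "R j < R k \<or> R j = R k \<and> k < j"
    and le: "R k \<le> (e(i := lift e h)) j"
  consider "j = i" "k \<noteq> i" | "k = i" "j \<noteq> i" | "j \<noteq> i" "k \<noteq> i" using jk by auto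
  thus "(e(i := lift e h)) k \<le> (e(i := lift e h)) j"
  proof cases
    case 1
    have "e k \<le> lift e h"
    proof (cases "R k \<le> h")
      case True
      hence "e k \<le> h" using closing_nested[OF e jk(1,2)] jk(3) 1 i by simp
      thus ?thesis using lift_bounds by simp
    qed (use le_lift[of k] jk le 1 in auto)
    thus ?thesis using 1 by simp
  next
    case 2
    hence "h \<le> e j" using closing_nested[OF e jk(1,2)] jk(3) le i by simp
    moreover have "e j \<noteq> h" using outermost[OF jk(1)] jk(3) 2 by auto
    moreover have "R j \<le> h" using closing_R_le[OF e i(1)] i(2) jk(3) 2 by auto
    ultimately show ?thesis using lift_le[OF e _ jk(1)] 2 by simp
  next
    case 3
    thus ?thesis using closing_nested[OF e jk(1,2)] jk(3) le by simp
  qed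
qed

end

end

section \<open>Rotations as elementary steps of the componentwise order\<close>

context bounce
begin

lemma set_east_heights:
  assumes "represents \<mu> e"
  shows "set (east_heights \<mu>) = e ` {1..n}"
proof -
  have "set_mset (mset (east_heights \<mu>)) = set_mset (image_mset e (mset_set {1..n}))"
    using assms by (simp only: represents_def)
  thus ?thesis by simp
qed

lemma horiz_point:
  assumes "represents \<mu> e" "k \<le> length \<mu>" "path_point \<mu> k = (x, y)"
  shows "horiz \<nu> (path_point \<mu> k) = int (closed R y) - int x"
  using path_point_bounds(3)[OF assms(2,3)] assms(1) horiz_eq[of y \<nu> x] north
  by (simp add: assms(3) cum_width_Suc[OF represents_\<nu>] represents_def)

lemma next_same_horiz_valley:
  assumes e: "closing e" "represents \<mu> e" and valley: "is_valley \<mu> k" "path_point \<mu> k = (x, h)"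
  obtains j x' where "next_same_horiz \<nu> \<mu> k = j" "k < j" "j \<le> length \<mu>"
    "path_point \<mu> j = (x', lift e h)"
proof -
  have \<mu>: "count_list \<mu> North = n" using e(2) by (simp add: represents_def)
  note vp = valley_point[OF valley]
  have h: "h < n" and x: "x = closed e h"
    using vp(1,2) \<mu> by (simp_all add: cum_width_Suc[OF e(2)])
  have k: "k < length \<mu>" "k = x + h"
    using valley path_point_bounds(4)[of k \<mu> x h] by (auto simp: is_valley_def)
  define v where "v = lift e h"
  have v: "h < v" "v \<le> n" using lift_bounds[OF e(1) h] by (auto simp: v_def)
  have mono: "closed f y \<le> closed f z" if "y \<le> z" for f y z
    unfolding closed_def using that by (intro card_mono) auto
  \<comment> \<open>The abscissa at height \<open>v\<close> for which \<open>horiz\<close> equals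
    its value at the valley; the subtraction does not truncate because
    \<open>closed R h \<le> closed R v\<close>.\<close>
  define x' where "x' = closed e h + closed R v - closed R h"
  have x': "x' + closed R h = closed e h + closed R v"
    using mono[of h v R] v by (simp add: x'_def)
  hence "x \<le> x'" using mono[of h v R] v by (simp add: x)
  have lower: "cum_width \<mu> v \<le> x'"
    using closed_lift_lower[OF e(1) h] x' by (simp add: cum_width_represents[OF e(2)] flip: v_def)
  have upper: "x' \<le> cum_width \<mu> (Suc v)"
    using closed_lift_upper[OF e(1) h] x' by (simp add: cum_width_Suc[OF e(2)] flip: v_def)
  have j: "x' + v \<le> length \<mu>" "path_point \<mu> (x' + v) = (x', v)"
    using path_point_eqI[OF lower upper] v \<mu> by auto
  have same: "horiz \<nu> (path_point \<mu> l) = horiz \<nu> (path_point \<mu> k) \<longleftrightarrow>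
      closed R (snd (path_point \<mu> l)) + closed e h = closed R h + fst (path_point \<mu> l)"
    if "l \<le> length \<mu>" for l
    using horiz_point[OF e(2) that, of "fst (path_point \<mu> l)" "snd (path_point \<mu> l)"]
      horiz_point[OF e(2) _ valley(2)] k by (auto simp: x)
  have "next_same_horiz \<nu> \<mu> k = x' + v"
    unfolding next_same_horiz_def
  proof (rule Least_equality)
    show "k < x' + v \<and> x' + v \<le> length \<mu> \<and>
        horiz \<nu> (path_point \<mu> (x' + v)) = horiz \<nu> (path_point \<mu> k)"
      using j x' same[of "x' + v"] \<open>x \<le> x'\<close> v k by auto
  next
    fix l assume l: "k < l \<and> l \<le> length \<mu> \<and>
        horiz \<nu> (path_point \<mu> l) = horiz \<nu> (path_point \<mu> k)"
    obtain xl yl where pl: "path_point \<mu> l = (xl, yl)" by fastforce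
    have b: "cum_width \<mu> yl \<le> xl" "xl \<le> closed e yl" "xl + yl = l"
      using path_point_bounds[of l \<mu> xl yl] l pl by (auto simp: cum_width_Suc[OF e(2)])
    have eq: "closed R yl + closed e h = closed R h + xl" using same[of l] l pl by simp
    \<comment> \<open>The valley is the last point at its height, so a later point is
      higher.\<close>
    have "h < yl"
    proof (rule ccontr)
      assume "\<not> h < yl"
      hence "xl \<le> closed e h" using mono[of yl h e] b(2) by simp
      thus False using \<open>\<not> h < yl\<close> b(3) l k(2) x by simp
    qed
    moreover have "\<not> yl < v"
      using closed_less_lift[OF e(1) h \<open>h < yl\<close>] eq b by (auto simp: v_def)
    moreover have "xl = x'" if "yl = v" using that eq x' by simp
    moreover have "x' \<le> xl" if "v < yl"
      using cum_width_mono[of "Suc v" yl \<mu>] that upper b by simp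
    ultimately show "x' + v \<le> l" using b by (cases "yl = v") auto
  qed
  thus ?thesis using that j \<open>x \<le> x'\<close> v k by (simp add: v_def)
qed

lemma exists_outermost:
  assumes "h \<in> e ` {1..n}"
  obtains i where "i \<in> {1..n}" "e i = h"
    "\<And>j. j \<in> {1..n} \<Longrightarrow> e j = h \<Longrightarrow> R i < R j \<or> R i = R j \<and> j \<le> i"
proof -
  define A where "A = {i \<in> {1..n}. e i = h}"
  define m where "m = Min (R ` A)"
  define B where "B = {i \<in> A. R i = m}"
  have A: "finite A" "A \<noteq> {}" using assms by (auto simp: A_def)
  hence "m \<in> R ` A" unfolding m_def by (intro Min_in) auto
  hence B: "finite B" "B \<noteq> {}" using A by (auto simp: B_def)
  have "Max B \<in> B" using B by (rule Max_in)
  show ?thesis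
  proof (rule that[of "Max B"])
    show "Max B \<in> {1..n}" "e (Max B) = h" using \<open>Max B \<in> B\<close> by (auto simp: B_def A_def)
    fix j assume "j \<in> {1..n}" "e j = h"
    hence j: "j \<in> A" by (simp add: A_def)
    hence "m \<le> R j" using A by (simp add: m_def)
    moreover have "R (Max B) = m" using \<open>Max B \<in> B\<close> by (simp add: B_def)
    moreover have "j \<le> Max B" if "R j = m" using that j B by (simp add: B_def)
    ultimately show "R (Max B) < R j \<or> R (Max B) = R j \<and> j \<le> Max B" by fastforce
  qed
qed

lemma image_mset_upd:
  assumes "i \<in> {1..n}"
  shows "add_mset (e i) (image_mset (e(i := v)) (mset_set {1..n}))
    = add_mset v (image_mset e (mset_set {1..n}))"
proof -
  have "image_mset (e(i := v)) (mset_set ({1..n} - {i})) = image_mset e (mset_set ({1..n} - {i}))"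
    by (intro image_mset_cong) auto
  thus ?thesis using assms by (simp add: mset_set.remove[of _ i] add_mset_commute)
qed

text \<open>For the multiset of heights any index closing at \<open>h\<close> may be the one that is
  raised; the choice of the outermost one serves to keep the family nested.\<close>

lemma rotation_represents:
  assumes e: "closing e" "represents \<mu> e" and valley: "is_valley \<mu> k" "path_point \<mu> k = (x, h)"
    and i: "i \<in> {1..n}" "e i = h"
  shows "represents (rotation \<nu> \<mu> k) (e(i := lift e h))"
proof -
  obtain j x' where j: "next_same_horiz \<nu> \<mu> k = j" "k < j" "j \<le> length \<mu>"
    "path_point \<mu> j = (x', lift e h)"
    using e valley by (rule next_same_horiz_valley)
  note rot = rotation_heights[OF valley j(4,1-3)]
  have "add_mset h (mset (east_heights (rotation \<nu> \<mu> k)))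
      = add_mset h (image_mset (e(i := lift e h)) (mset_set {1..n}))"
    using rot(2) image_mset_upd[OF i(1), of e "lift e h"] e(2) i(2) by (simp add: represents_def)
  thus ?thesis using rot(1) e(2) by (simp add: represents_def)
qed

lemma rotation_step:
  assumes e: "closing e" "represents \<mu> e" and rot: "(\<mu>, \<mu>') \<in> nu_rotations \<nu>"
  obtains e' where "closing e'" "represents \<mu>' e'" "\<And>i. i \<in> {1..n} \<Longrightarrow> e i \<le> e' i"
proof -
  obtain k where k: "is_valley \<mu> k" "\<mu>' = rotation \<nu> \<mu> k" using rot by (auto simp: nu_rotations_def)
  obtain x h where xh: "path_point \<mu> k = (x, h)" by fastforce
  have h: "h < n" using valley_point(1)[OF k(1) xh] e(2) by (simp add: represents_def)
  have "h \<in> e ` {1..n}" using valley_point(3)[OF k(1) xh] set_east_heights[OF e(2)] by simp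
  then obtain i where i: "i \<in> {1..n}" "e i = h"
    "\<And>j. j \<in> {1..n} \<Longrightarrow> e j = h \<Longrightarrow> R i < R j \<or> R i = R j \<and> j \<le> i"
    by (rule exists_outermost) blast
  show ?thesis
  proof (rule that)
    show "closing (e(i := lift e h))" using closing_lift[OF e(1) h i] .
    show "represents \<mu>' (e(i := lift e h))"
      using rotation_represents[OF e k(1) xh i(1,2)] by (simp add: k(2))
    show "e j \<le> (e(i := lift e h)) j" for j
      using lift_bounds(1)[OF e(1) h] i(2) by simp
  qed
qed

text \<open>Induction on the total difference. At a height \<open>h\<close> where some index still
  has to rise, the outermost bracket closing at \<open>h\<close> has to rise as well, and one
  rotation lifts it without overshooting \<open>e'\<close>.\<close>

lemma rotations_if_le:
  assumes "closing e" "represents \<mu> e" "closing e'" "represents \<mu>' e'"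
    and "\<And>i. i \<in> {1..n} \<Longrightarrow> e i \<le> e' i"
  shows "(\<mu>, \<mu>') \<in> (nu_rotations \<nu>)\<^sup>*"
  using assms
proof (induction "\<Sum>i\<in>{1..n}. e' i - e i" arbitrary: e \<mu> rule: less_induct)
  case less
  note e = less.prems(1,2) and e' = less.prems(3,4) and le = less.prems(5)
  show ?case
  proof (cases "\<forall>i\<in>{1..n}. e i = e' i")
    case True
    hence "represents \<mu> e'" using represents_cong[of e e' \<mu>] e(2) by blast
    hence "\<mu> = \<mu>'" using e'(2) by (rule represents_unique)
    thus ?thesis by simp
  next
    case False
    then obtain i0 where i0: "i0 \<in> {1..n}" "e i0 < e' i0" using le by (metis order.not_eq_order_implies_strict)
    define h where "h = e i0"
    have h: "h < n" using i0 closing_le[OF e'(1) i0(1)] by (simp add: h_def)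
    have "h \<in> e ` {1..n}" using i0 by (simp add: h_def)
    then obtain i where i: "i \<in> {1..n}" "e i = h"
      "\<And>j. j \<in> {1..n} \<Longrightarrow> e j = h \<Longrightarrow> R i < R j \<or> R i = R j \<and> j \<le> i"
      by (rule exists_outermost) blast
    \<comment> \<open>In \<open>e'\<close> the bracket \<open>i\<close> encloses \<open>i0\<close>,
      so it closes no earlier than \<open>i0\<close>, which closes after \<open>h\<close>.\<close>
    have "h < e' i"
    proof (cases "i = i0")
      case False
      have "R i0 \<le> h" using closing_R_le[OF e(1) i0(1)] by (simp add: h_def)
      hence "R i0 \<le> e' i" using le[OF i(1)] i(2) by simp
      hence "e' i0 \<le> e' i"
        using closing_nested[OF e'(1) i(1) i0(1)] i(3)[OF i0(1)] False by (force simp: h_def)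
      thus ?thesis using i0(2) by (simp add: h_def)
    qed (use i0 in \<open>simp add: h_def\<close>)
    moreover have "R i \<le> h" using closing_R_le[OF e(1) i(1)] i(2) by simp
    ultimately have lift_le': "lift e h \<le> e' i"
      using lift_le[OF e(1) h e'(1) _ i(1)] le[of "h + 1"] h by simp
    have "h \<in> set (east_heights \<mu>)" using set_east_heights[OF e(2)] i by auto
    moreover have "h < count_list \<mu> North" using e(2) h by (simp add: represents_def)
    ultimately obtain k x where k: "is_valley \<mu> k" "path_point \<mu> k = (x, h)"
      using valley_exists[of h \<mu>] by auto
    define e1 where "e1 = e(i := lift e h)"
    define \<mu>1 where "\<mu>1 = rotation \<nu> \<mu> k"
    have e1: "closing e1" "represents \<mu>1 e1"
      using closing_lift[OF e(1) h i] rotation_represents[OF e k i(1,2)] by (simp_all add: e1_def \<mu>1_def)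
    have lift_gt: "e i < lift e h" using lift_bounds(1)[OF e(1) h] i(2) by simp
    have step: "(\<mu>, \<mu>1) \<in> nu_rotations \<nu>"
      using represents_above[OF e] represents_above[OF e1] k(1) by (auto simp: nu_rotations_def \<mu>1_def)
    have "(\<Sum>j\<in>{1..n}. e' j - e1 j) < (\<Sum>j\<in>{1..n}. e' j - e j)"
    proof (rule sum_strict_mono_ex1)
      show "\<forall>j\<in>{1..n}. e' j - e1 j \<le> e' j - e j" using lift_gt by (auto simp: e1_def)
      show "\<exists>j\<in>{1..n}. e' j - e1 j < e' j - e j"
        using lift_gt lift_le' i(1) by (intro bexI[of _ i]) (auto simp: e1_def)
    qed simp
    moreover have "e1 j \<le> e' j" if "j \<in> {1..n}" for j using le[OF that] lift_le' by (simp add: e1_def)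
    ultimately have "(\<mu>1, \<mu>') \<in> (nu_rotations \<nu>)\<^sup>*" using less.hyps e1 e' by blast
    thus ?thesis using step by (meson converse_rtrancl_into_rtrancl)
  qed
qed

text \<open>Every rotation raises the family weakly, and the family reached at the end of the chain
  is \<open>e'\<close> by uniqueness.\<close>

lemma le_if_rotations:
  assumes "(\<mu>, \<mu>') \<in> (nu_rotations \<nu>)\<^sup>*" "closing e" "represents \<mu> e"
    "closing e'" "represents \<mu>' e'" "i \<in> {1..n}"
  shows "e i \<le> e' i"
proof -
  have "\<exists>d. closing d \<and> represents \<mu>' d \<and> (\<forall>i\<in>{1..n}. e i \<le> d i)"
    using assms(1)
  proof induction
    case base
    thus ?case using assms(2,3) by blast
  next
    case (step y z)
    then obtain d where d: "closing d" "represents y d" "\<forall>i\<in>{1..n}. e i \<le> d i" by blast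
    obtain d' where "closing d'" "represents z d'" "\<And>i. i \<in> {1..n} \<Longrightarrow> d i \<le> d' i"
      using rotation_step[OF d(1,2) step.hyps(2)] by blast
    thus ?case using d(3) by (meson order_trans)
  qed
  then obtain d where d: "closing d" "represents \<mu>' d" "\<forall>i\<in>{1..n}. e i \<le> d i" by blast
  have "d i = e' i" using d(1,2) assms(4-6) by (intro closing_unique) auto
  thus ?thesis using d(3) assms(6) by metis
qed

lemma partial_order_nu_tamari: "partial_order_on (paths_above \<nu>) (nu_tamari_le \<nu>)"
proof -
  have "antisym (nu_tamari_le \<nu>)"
  proof (rule antisymI)
    fix \<mu> \<mu>' assume *: "(\<mu>, \<mu>') \<in> nu_tamari_le \<nu>" "(\<mu>', \<mu>) \<in> nu_tamari_le \<nu>"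
    then obtain e e' where e: "closing e" "represents \<mu> e" and e': "closing e'" "represents \<mu>' e'"
      using above_represented unfolding nu_tamari_le_def by (metis IntD2 mem_Sigma_iff)
    have "e i = e' i" if "i \<in> {1..n}" for i
      using * le_if_rotations[OF _ e e' that] le_if_rotations[OF _ e' e that]
      by (auto simp: nu_tamari_le_def intro: order_antisym)
    hence "represents \<mu> e'" using represents_cong[of e e' \<mu>] e(2) by blast
    thus "\<mu> = \<mu>'" using e'(2) by (rule represents_unique)
  qed
  moreover have "trans (nu_tamari_le \<nu>)"
    unfolding nu_tamari_le_def by (intro trans_Int trans_rtrancl) (auto intro: transI)
  ultimately show ?thesis
    unfolding partial_order_on_def preorder_on_def by (auto simp: nu_tamari_le_def refl_on_def)
qed

end

subsection \<open>Compositions\<close>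

lemma psum_mono: "a \<le> b \<Longrightarrow> psum \<alpha> a \<le> psum \<alpha> b"
  unfolding psum_def by (metis le_add1 le_add_diff_inverse sum_list_append take_add)

lemma psum_simps [simp]: "psum \<alpha> 0 = 0" "psum \<alpha> (length \<alpha>) = sum_list \<alpha>"
  by (simp_all add: psum_def)

lemma region_index_eqI:
  assumes "1 \<le> a" "a \<le> length \<alpha>" "psum \<alpha> (a - 1) < i" "i \<le> psum \<alpha> a"
  shows "region_index \<alpha> i = a"
  unfolding region_index_def
proof (rule the_equality)
  show "a \<in> {1..length \<alpha>} \<and> i \<in> region \<alpha> a" using assms by (simp add: region_def)
next
  fix b assume b: "b \<in> {1..length \<alpha>} \<and> i \<in> region \<alpha> b"
  have "a < b \<Longrightarrow> psum \<alpha> a \<le> psum \<alpha> (b - 1)" "b < a \<Longrightarrow> psum \<alpha> b \<le> psum \<alpha> (a - 1)"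
    by (simp_all add: psum_mono)
  thus "b = a" using b assms by (cases a b rule: linorder_cases) (auto simp: region_def)
qed

lemma region_index:
  assumes "1 \<le> i" "i \<le> sum_list \<alpha>"
  shows "1 \<le> region_index \<alpha> i" "region_index \<alpha> i \<le> length \<alpha>"
    "psum \<alpha> (region_index \<alpha> i - 1) < i" "i \<le> psum \<alpha> (region_index \<alpha> i)"
proof -
  \<comment> \<open>The first partial sum that reaches \<open>i\<close> ends its region; this
    witness gives the definite description in \<open>region_index\<close> its value.\<close>
  define a where "a = (LEAST a. i \<le> psum \<alpha> a)"
  have a: "i \<le> psum \<alpha> a" "a \<le> length \<alpha>"
    unfolding a_def using assms LeastI[of "\<lambda>a. i \<le> psum \<alpha> a" "length \<alpha>"]
      Least_le[of "\<lambda>a. i \<le> psum \<alpha> a" "length \<alpha>"] by simp_all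
  have "a \<noteq> 0" using a assms by (intro notI) simp
  hence "psum \<alpha> (a - 1) < i" using not_less_Least[of "a - 1" "\<lambda>a. i \<le> psum \<alpha> a"] by (simp add: a_def)
  moreover from this have "region_index \<alpha> i = a" using a \<open>a \<noteq> 0\<close> by (intro region_index_eqI) auto
  ultimately show "1 \<le> region_index \<alpha> i" "region_index \<alpha> i \<le> length \<alpha>"
    "psum \<alpha> (region_index \<alpha> i - 1) < i" "i \<le> psum \<alpha> (region_index \<alpha> i)"
    using a \<open>a \<noteq> 0\<close> by simp_all
qed

definition region_end :: "nat list \<Rightarrow> nat \<Rightarrow> nat" where
  "region_end \<alpha> i = psum \<alpha> (region_index \<alpha> i)"

lemma region_end_less:
  assumes "1 \<le> j" "j \<le> sum_list \<alpha>" "region_index \<alpha> i < region_index \<alpha> j"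
  shows "region_end \<alpha> i < region_end \<alpha> j"
proof -
  have "psum \<alpha> (region_index \<alpha> i) \<le> psum \<alpha> (region_index \<alpha> j - 1)"
    using assms(3) by (intro psum_mono) simp
  thus ?thesis using region_index[OF assms(1,2)] by (simp add: region_end_def)
qed

lemma region_end_eq_iff:
  assumes "1 \<le> i" "i \<le> sum_list \<alpha>" "1 \<le> j" "j \<le> sum_list \<alpha>"
  shows "region_end \<alpha> i = region_end \<alpha> j \<longleftrightarrow> region_index \<alpha> i = region_index \<alpha> j"
  using region_end_less[of j \<alpha> i] region_end_less[of i \<alpha> j] assms
  by (metis linorder_neqE_nat nat_less_le region_end_def)

lemma region_end_snoc:
  "1 \<le> i \<Longrightarrow> i \<le> sum_list \<alpha> \<Longrightarrow> region_end (\<alpha> @ [a]) i = region_end \<alpha> i"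
  "sum_list \<alpha> < i \<Longrightarrow> i \<le> sum_list \<alpha> + a \<Longrightarrow> region_end (\<alpha> @ [a]) i = sum_list \<alpha> + a"
proof -
  have psum: "psum (\<alpha> @ [a]) b = psum \<alpha> b" if "b \<le> length \<alpha>" for b
    using that by (simp add: psum_def)
  show "region_end (\<alpha> @ [a]) i = region_end \<alpha> i" if "1 \<le> i" "i \<le> sum_list \<alpha>"
  proof -
    note i = region_index[OF that]
    have "region_index (\<alpha> @ [a]) i = region_index \<alpha> i"
      using i by (intro region_index_eqI) (simp_all add: psum)
    thus ?thesis using i by (simp add: region_end_def psum)
  qed
  show "region_end (\<alpha> @ [a]) i = sum_list \<alpha> + a" if "sum_list \<alpha> < i" "i \<le> sum_list \<alpha> + a"
  proof -
    have "psum (\<alpha> @ [a]) (Suc (length \<alpha>)) = sum_list \<alpha> + a" by (simp add: psum_def)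
    moreover from this have "region_index (\<alpha> @ [a]) i = Suc (length \<alpha>)"
      using that by (intro region_index_eqI) (simp_all add: psum)
    ultimately show ?thesis by (simp add: region_end_def)
  qed
qed

lemma bounce_path_snoc:
  "bounce_path (\<alpha> @ [a]) = bounce_path \<alpha> @ replicate a North @ replicate a East"
  by (simp add: bounce_path_def)

lemma count_bounce_path: "count_list (bounce_path \<alpha>) North = sum_list \<alpha>"
  by (induction \<alpha> rule: rev_induct)
    (simp_all add: bounce_path_snoc count_list_replicate, simp add: bounce_path_def)

text \<open>Parts are appended at the right end, which keeps earlier region ends; a new part
  \<open>a\<close> adds \<open>a\<close> east steps at the new total height.\<close>

lemma east_heights_bounce_path:
  "mset (east_heights (bounce_path \<alpha>)) = image_mset (region_end \<alpha>) (mset_set {1..sum_list \<alpha>})"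
proof (induction \<alpha> rule: rev_induct)
  case Nil
  thus ?case by (simp add: bounce_path_def)
next
  case (snoc a \<alpha>)
  let ?n = "sum_list \<alpha>"
  have "{1..?n + a} = {1..?n} \<union> {?n + 1..?n + a}" by auto
  hence split: "mset_set {1..?n + a} = mset_set {1..?n} + mset_set {?n + 1..?n + a}"
    by (simp add: mset_set_Union)
  have "image_mset (region_end (\<alpha> @ [a])) (mset_set {1..?n}) = image_mset (region_end \<alpha>) (mset_set {1..?n})"
    by (intro image_mset_cong) (auto simp: region_end_snoc)
  moreover have "image_mset (region_end (\<alpha> @ [a])) (mset_set {?n + 1..?n + a})
      = image_mset (\<lambda>_. ?n + a) (mset_set {?n + 1..?n + a})"
    by (intro image_mset_cong) (auto simp: region_end_snoc)
  moreover have "\<dots> = replicate_mset a (?n + a)" by (simp add: image_mset_const_eq)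
  ultimately show ?case
    using snoc.IH split
    by (simp add: bounce_path_snoc east_heights_append count_list_replicate count_bounce_path add.commute)
qed

text \<open>As \<alpha> stays a parameter, the constants of the locales that depend on
  \<open>n\<close> or \<open>R\<close> take it as their first argument from here on.\<close>

interpretation bounce "sum_list \<alpha>" "region_end \<alpha>" "bounce_path \<alpha>" for \<alpha>
proof
  fix i assume i: "1 \<le> i" "i \<le> sum_list \<alpha>"
  show "i \<le> region_end \<alpha> i" using region_index[OF i] by (simp add: region_end_def)
  show "region_end \<alpha> i \<le> sum_list \<alpha>"
    using psum_mono[of "region_index \<alpha> i" "length \<alpha>" \<alpha>] region_index[OF i] by (simp add: region_end_def)
  fix j assume j: "i \<le> j" "j \<le> region_end \<alpha> i"
  have "region_index \<alpha> j = region_index \<alpha> i"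
    using region_index[OF i] j by (intro region_index_eqI) (simp_all add: region_end_def)
  thus "region_end \<alpha> j = region_end \<alpha> i" by (simp add: region_end_def)
qed (simp_all add: count_bounce_path east_heights_bounce_path)

text \<open>Adjacent comparisons extend to all pairs of a region by induction on the right position,
  since a region is an interval.\<close>

lemma alpha_perms_iff: "w \<in> alpha_perms \<alpha> \<longleftrightarrow> increasing \<alpha> w"
proof
  assume inc: "increasing \<alpha> w"
  thus "w \<in> alpha_perms \<alpha>"
    using increasingD[OF inc] by (simp add: alpha_perms_def increasing_def region_end_eq_iff)
next
  assume w: "w \<in> alpha_perms \<alpha>"
  have "w i < w j" if "1 \<le> i" "i < j" "j \<le> sum_list \<alpha>" "region_end \<alpha> i = region_end \<alpha> j" for i j
    using that
  proof (induction j)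
    case (Suc j)
    have j: "region_end \<alpha> j = region_end \<alpha> i" "j \<le> sum_list \<alpha>" "1 \<le> j"
      using Suc.prems R_const[of i \<alpha> j] R_ge[of "Suc j" \<alpha>] by auto
    hence "w j < w (Suc j)"
      using w Suc.prems region_end_eq_iff[of j \<alpha> "Suc j"] by (simp add: alpha_perms_def)
    moreover have "w i < w j" if "i < j" using Suc.IH[OF _ that] Suc.prems j by simp
    ultimately show ?case using Suc.prems(2) by (cases "i = j") auto
  qed simp
  thus "increasing \<alpha> w" using w by (simp add: increasing_def alpha_perms_def)
qed

lemma has_231_pattern_iff: "has_231_pattern \<alpha> w \<longleftrightarrow> \<not> avoiding \<alpha> w"
proof
  assume "has_231_pattern \<alpha> w"
  then obtain i j k where "1 \<le> i" "i < j" "j < k" "k \<le> sum_list \<alpha>"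
    "region_index \<alpha> i \<noteq> region_index \<alpha> j" "region_index \<alpha> j \<noteq> region_index \<alpha> k"
    "w i < w j" "w i = w k + 1"
    unfolding has_231_pattern_def by blast
  moreover from this have "region_end \<alpha> i \<noteq> region_end \<alpha> j" "region_end \<alpha> j \<noteq> region_end \<alpha> k"
    by (simp_all add: region_end_eq_iff)
  ultimately show "\<not> avoiding \<alpha> w" unfolding avoiding_def by blast
next
  assume "\<not> avoiding \<alpha> w"
  then obtain i j k where ijk: "1 \<le> i" "i < j" "j < k" "k \<le> sum_list \<alpha>"
    "region_end \<alpha> i \<noteq> region_end \<alpha> j" "region_end \<alpha> j \<noteq> region_end \<alpha> k"
    "w i < w j" "w i = w k + 1"
    unfolding avoiding_def by blast
  \<comment> \<open>Region ends increase weakly, so equality here would squeeze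
    \<open>region_end \<alpha> j\<close> between equal numbers.\<close>
  moreover have "region_end \<alpha> i \<noteq> region_end \<alpha> k"
    using R_mono[of i j \<alpha>] R_mono[of j k \<alpha>] ijk by simp
  ultimately have "region_index \<alpha> i \<noteq> region_index \<alpha> j" "region_index \<alpha> j \<noteq> region_index \<alpha> k"
    "region_index \<alpha> i \<noteq> region_index \<alpha> k"
    by (simp_all flip: region_end_eq_iff)
  thus "has_231_pattern \<alpha> w" unfolding has_231_pattern_def using ijk by blast
qed

lemma alpha_perms_231_iff: "w \<in> alpha_perms_231 \<alpha> \<longleftrightarrow> increasing \<alpha> w \<and> avoiding \<alpha> w"
  by (simp add: alpha_perms_231_def alpha_perms_iff has_231_pattern_iff)

text \<open>The admissible positions are the admissible lengths shifted by the region end, and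
  \<open>Max\<close> commutes with the shift.\<close>

lemma code_eq_reach:
  assumes "1 \<le> i" "i \<le> sum_list \<alpha>"
  shows "code \<alpha> w i + psum \<alpha> (region_index \<alpha> i) = reach \<alpha> w i"
proof -
  define s where "s = region_end \<alpha> i"
  define K where "K = {k. s + k \<le> sum_list \<alpha> \<and> (\<forall>l\<in>{1..k}. w i > w (s + l))}"
  have "s \<le> sum_list \<alpha>" using R_le assms by (simp add: s_def)
  hence K: "finite K" "K \<noteq> {}"
    by (auto simp: K_def intro!: finite_subset[of _ "{..sum_list \<alpha>}"] exI[of _ 0])
  have "reach_set \<alpha> w i = (\<lambda>k. k + s) ` K"
  proof (intro equalityI subsetI)
    fix m assume m: "m \<in> reach_set \<alpha> w i"
    hence "m - s \<in> K" "m = m - s + s" by (auto simp: reach_set_def K_def s_def)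
    thus "m \<in> (\<lambda>k. k + s) ` K" by blast
  next
    fix m assume "m \<in> (\<lambda>k. k + s) ` K"
    then obtain k where k: "m = k + s" "k \<in> K" by blast
    have "w l < w i" if "s < l" "l \<le> m" for l
      using k that by (auto simp: K_def dest!: bspec[of _ _ "l - s"])
    thus "m \<in> reach_set \<alpha> w i" using k by (simp add: reach_set_def K_def flip: s_def)
  qed
  moreover have "Max K + s = Max ((\<lambda>k. k + s) ` K)"
    using K by (intro mono_Max_commute) (auto intro: monoI)
  moreover have "code \<alpha> w i = Max K"
    by (simp add: code_def Let_def K_def s_def region_end_def)
  ultimately show ?thesis by (simp add: reach_def s_def region_end_def)
qed

text \<open>Each width of the path is the size of a fibre of \<open>reach\<close>, hence the
  multiplicity of that height. Heights beyond \<open>n\<close> have none, as \<open>reach\<close> is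
  at most \<open>n\<close>.\<close>

lemma represents_phi: "represents \<alpha> (phi \<alpha> w) (reach \<alpha> w)"
  unfolding represents_def
proof
  let ?n = "sum_list \<alpha>" and ?f = "map (code_count \<alpha> w) [0..<sum_list \<alpha> + 1]"
  show "count_list (phi \<alpha> w) North = ?n"
    using count_list_path_of[of ?f] by (simp add: phi_def del: upt_Suc)
  show "mset (east_heights (phi \<alpha> w)) = image_mset (reach \<alpha> w) (mset_set {1..?n})"
  proof (rule multiset_eqI)
    fix h
    have "count (image_mset (reach \<alpha> w) (mset_set {1..?n})) h = card {j \<in> {1..?n}. reach \<alpha> w j = h}"
      by (simp add: count_conv_size_mset filter_mset_image_mset)
    also have "{j \<in> {1..?n}. reach \<alpha> w j = h}
        = {j. 1 \<le> j \<and> j \<le> ?n \<and> code \<alpha> w j + psum \<alpha> (region_index \<alpha> j) = h}"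
      by (auto simp: code_eq_reach)
    finally have count: "count (image_mset (reach \<alpha> w) (mset_set {1..?n})) h = code_count \<alpha> w h"
      by (simp add: code_count_def)
    moreover have "code_count \<alpha> w h = 0" if "\<not> h \<le> ?n"
      using that reach_le[of _ \<alpha> w] by (auto simp: code_count_def code_eq_reach card_eq_0_iff)
    ultimately show "count (mset (east_heights (phi \<alpha> w))) h
        = count (image_mset (reach \<alpha> w) (mset_set {1..?n})) h"
      using count_east_heights_path_of[of ?f h]
      by (auto simp: phi_def less_Suc_eq_le simp del: upt_Suc)
  qed
qed

lemma closing_reach: "w \<in> alpha_perms_231 \<alpha> \<Longrightarrow> closing \<alpha> (reach \<alpha> w)"
  using nested_on_reach[of \<alpha> w] by (simp add: alpha_perms_231_iff closing_def reach_le)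

lemma partial_order_alpha_tamari: "partial_order_on (alpha_perms_231 \<alpha>) (alpha_tamari_le \<alpha>)"
proof -
  have "antisym (alpha_tamari_le \<alpha>)"
    by (rule antisymI)
      (auto simp: alpha_tamari_le_def alpha_perms_231_iff increasing_def intro: permutes_eq_if_Inv_eq)
  moreover have "trans (alpha_tamari_le \<alpha>)"
    by (rule transI) (auto simp: alpha_tamari_le_def)
  ultimately show ?thesis
    unfolding partial_order_on_def preorder_on_def by (auto simp: alpha_tamari_le_def refl_on_def)
qed

text \<open>A path determines its nested family, which determines the inversion set and so the
  permutation. Conversely every path above has such a family, and \<open>exists_reach_eq\<close>
  realises it.\<close>

lemma bij_betw_phi: "bij_betw (phi \<alpha>) (alpha_perms_231 \<alpha>) (paths_above (bounce_path \<alpha>))"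
proof (rule bij_betw_imageI)
  show "inj_on (phi \<alpha>) (alpha_perms_231 \<alpha>)"
  proof (rule inj_onI)
    fix u v assume uv: "u \<in> alpha_perms_231 \<alpha>" "v \<in> alpha_perms_231 \<alpha>" "phi \<alpha> u = phi \<alpha> v"
    have "reach \<alpha> u i = reach \<alpha> v i" if "i \<in> {1..sum_list \<alpha>}" for i
      using closing_unique[OF closing_reach[OF uv(1)] closing_reach[OF uv(2)] represents_phi] that
        represents_phi[of \<alpha> v] by (simp add: uv(3))
    hence "Inv (sum_list \<alpha>) u = Inv (sum_list \<alpha>) v"
      using uv(1,2) Inv_subset_iff[of \<alpha> u v] Inv_subset_iff[of \<alpha> v u]
      by (intro equalityI) (simp_all add: alpha_perms_231_iff)
    thus "u = v" using uv by (intro permutes_eq_if_Inv_eq) (auto simp: alpha_perms_231_iff increasing_def)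
  qed
  show "phi \<alpha> ` alpha_perms_231 \<alpha> = paths_above (bounce_path \<alpha>)"
  proof (intro equalityI subsetI)
    fix \<mu> assume "\<mu> \<in> paths_above (bounce_path \<alpha>)"
    then obtain e where e: "closing \<alpha> e" "represents \<alpha> \<mu> e" by (rule above_represented)
    then obtain w where w: "increasing \<alpha> w" "avoiding \<alpha> w"
      and "\<forall>i\<in>{1..sum_list \<alpha>}. reach \<alpha> w i = e i"
      using exists_reach_eq[of \<alpha> e] by (auto simp: closing_def)
    hence "represents \<alpha> (phi \<alpha> w) e"
      using represents_cong[of \<alpha> "reach \<alpha> w" e] represents_phi by blast
    hence "\<mu> = phi \<alpha> w" using e(2) by (intro represents_unique)
    thus "\<mu> \<in> phi \<alpha> ` alpha_perms_231 \<alpha>" using w by (auto simp: alpha_perms_231_iff)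
  qed (use represents_above[OF closing_reach represents_phi] in auto)
qed

lemma phi_le_iff:
  assumes "u \<in> alpha_perms_231 \<alpha>" "v \<in> alpha_perms_231 \<alpha>"
  shows "(u, v) \<in> alpha_tamari_le \<alpha> \<longleftrightarrow> (phi \<alpha> u, phi \<alpha> v) \<in> nu_tamari_le (bounce_path \<alpha>)"
proof -
  note closing = closing_reach[OF assms(1)] closing_reach[OF assms(2)]
  note u = closing(1) represents_phi[of \<alpha> u] and v = closing(2) represents_phi[of \<alpha> v]
  have "(u, v) \<in> alpha_tamari_le \<alpha> \<longleftrightarrow> (\<forall>i\<in>{1..sum_list \<alpha>}. reach \<alpha> u i \<le> reach \<alpha> v i)"
    using assms Inv_subset_iff[of \<alpha> u v] by (simp add: alpha_tamari_le_def alpha_perms_231_iff)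
  also have "\<dots> \<longleftrightarrow> (phi \<alpha> u, phi \<alpha> v) \<in> (nu_rotations (bounce_path \<alpha>))\<^sup>*"
    using rotations_if_le[OF u v] le_if_rotations[OF _ u v] by blast
  also have "\<dots> \<longleftrightarrow> (phi \<alpha> u, phi \<alpha> v) \<in> nu_tamari_le (bounce_path \<alpha>)"
    using represents_above[OF u] represents_above[OF v] by (simp add: nu_tamari_le_def)
  finally show ?thesis .
qed

theorem proposition6p1:
  fixes n :: nat and \<alpha> :: "nat list"
  assumes "n > 0" and "is_composition n \<alpha>"
  shows "poset_iso (alpha_perms_231 \<alpha>) (alpha_tamari_le \<alpha>)
                   (paths_above (bounce_path \<alpha>)) (nu_tamari_le (bounce_path \<alpha>))
                   (phi \<alpha>)"
  unfolding poset_iso_def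
  using partial_order_alpha_tamari partial_order_nu_tamari bij_betw_phi phi_le_iff by blast

end
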